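(* The following two feasibility problems are equivalent, i.e. one admits a solution if and only if the other does. (1) Find $K_i\in\mathbb R^{m\times n}$, $P_i\succ0$ ($i\in\mathcal I$), $Q\succcurlyeq0$ and $\Pi=[\pi_{i,j}]\in\mathcal M$ such that for all $i\in\mathcal I$ and all $(A_i,B_i)\in\mathcal C_i$, $$(A_i+B_iK_i)^\top P_i+P_i(A_i+B_iK_i)+\sum_{j\in\mathcal I}\pi_{j,i}P_j+Q\prec0 .$$ (2) Find $K_i\in\mathbb R^{m\times n}$, $P_i\succ0$ ($i\in\mathcal I$), $Q\succ0$ and $\Pi=[\pi_{i,j}]\in\mathcal M_+$ such that for all $i\in\mathcal I$ and all $(A_i,B_i)\in\mathcal C_i$, $$(A_i+B_iK_i)^\top P_i+P_i(A_i+B_iK_i)+\sum_{j\in\mathcal I}\pi_{j,i}P_j+Q\preccurlyeq0 .$$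
   Context: Let $\mathcal I=\{1,\dots,N\}$. For each $i\in\mathcal I$, true (unknown) matrices $\bar A_i\in\mathbb R^{n\times n}$, $\bar B_i\in\mathbb R^{n\times m}$ are given, together with data matrices $X_i,\dot X_i\in\mathbb R^{n\times T_i}$, $U_i\in\mathbb R^{m\times T_i}$ (here $\dot X_i$ is just a name) satisfying $\dot X_i=\bar A_iX_i+\bar B_iU_i+\bar W_i$ for an unknown $\bar W_i\in\mathcal W_i$, where $$\mathcal W_i:=\Big\{W\in\mathbb R^{n\times T_i}\ \Big|\ \begin{bmatrix} I \\ W^\top\end{bmatrix}^\top\Phi^i\begin{bmatrix} I \\ W^\top\end{bmatrix}\succcurlyeq 0\Big\},\qquad \Phi^i=\begin{bmatrix}\Phi^i_{1,1}&\Phi^i_{1,2} \\ {\Phi^i_{1,2}}^\top&\Phi^i_{2,2}\end{bmatrix}$$ with known symmetric $\Phi^i$ and $\Phi^i_{2,2}\prec0$ ($\Phi^i_{1,1}$ is $n\times n$, $\Phi^i_{2,2}$ is $T_i\times T_i$). The compatibility set (possibly unbounded) is $\mathcal C_i:=\{(A_i,B_i)\in\mathbb R^{n\times n}\times\mathbb R^{n\times m}\mid \exists W\in\mathcal W_i:\ \dot X_i=A_iX_i+B_iU_i+W\}$. $P_i$ and $Q$ are symmetric $n\times n$ matrices. $\mathcal M:=\{\Pi\in\mathbb R^{N\times N}\mid \pi_{i,j}\ge0\ \forall i\ne j,\ \sum_{i=1}^N\pi_{i,j}=0\ \forall j\}$ and $\mathcal M_+:=\{\Pi\in\mathbb R^{N\times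 N}\mid \pi_{i,j}>0\ \forall i\ne j,\ \sum_{i=1}^N\pi_{i,j}=0\ \forall j\}$. *)

theory Defs
  imports "Jordan_Normal_Form.Matrix" Complex_Main
begin

text \<open>
  Dimensions are natural numbers constrained by \<open>carrier_mat\<close>, since the number of samples
  \<open>T i\<close> varies with the mode \<open>i\<close>. Modes are numbered \<open>0, ..., N - 1\<close>,
  in line with the zero-based indexing of matrix entries.
\<close>

definition symmetric_mat :: "nat \<Rightarrow> real mat \<Rightarrow> bool" where
  "symmetric_mat n M \<longleftrightarrow> M \<in> carrier_mat n n \<and> M\<^sup>T = M"

text \<open>All definiteness notions include symmetry.\<close>

definition pos_def :: "nat \<Rightarrow> real mat \<Rightarrow> bool" where
  "pos_def n M \<longleftrightarrow> symmetric_mat n M \<and>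
     (\<forall>v \<in> carrier_vec n. v \<noteq> 0\<^sub>v n \<longrightarrow> v \<bullet> (M *\<^sub>v v) > 0)"

definition pos_semidef :: "nat \<Rightarrow> real mat \<Rightarrow> bool" where
  "pos_semidef n M \<longleftrightarrow> symmetric_mat n M \<and> (\<forall>v \<in> carrier_vec n. v \<bullet> (M *\<^sub>v v) \<ge> 0)"

definition neg_def :: "nat \<Rightarrow> real mat \<Rightarrow> bool" where
  "neg_def n M \<longleftrightarrow> symmetric_mat n M \<and>
     (\<forall>v \<in> carrier_vec n. v \<noteq> 0\<^sub>v n \<longrightarrow> v \<bullet> (M *\<^sub>v v) < 0)"

definition neg_semidef :: "nat \<Rightarrow> real mat \<Rightarrow> bool" where
  "neg_semidef n M \<longleftrightarrow> symmetric_mat n M \<and> (\<forall>v \<in> carrier_vec n. v \<bullet> (M *\<^sub>v v) \<le> 0)"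

definition noise_set :: "nat \<Rightarrow> nat \<Rightarrow> real mat \<Rightarrow> real mat set" where
  "noise_set n T \<Phi> = {W \<in> carrier_mat n T.
     pos_semidef n ((1\<^sub>m n @\<^sub>r W\<^sup>T)\<^sup>T * \<Phi> * (1\<^sub>m n @\<^sub>r W\<^sup>T))}"

definition compat_set ::
    "nat \<Rightarrow> nat \<Rightarrow> real mat \<Rightarrow> real mat \<Rightarrow> real mat \<Rightarrow> real mat set \<Rightarrow> (real mat \<times> real mat) set" where
  "compat_set n m Xdot X U \<W> = {(A, B). A \<in> carrier_mat n n \<and> B \<in> carrier_mat n m \<and>
     (\<exists>W \<in> \<W>. Xdot = A * X + B * U + W)}"

definition rate_mats :: "nat \<Rightarrow> real mat set" where
  "rate_mats N = {\<pi> \<in> carrier_mat N N.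
     (\<forall>i<N. \<forall>j<N. i \<noteq> j \<longrightarrow> \<pi> $$ (i, j) \<ge> 0) \<and> (\<forall>j<N. (\<Sum>i<N. \<pi> $$ (i, j)) = 0)}"

definition pos_rate_mats :: "nat \<Rightarrow> real mat set" where
  "pos_rate_mats N = {\<pi> \<in> carrier_mat N N.
     (\<forall>i<N. \<forall>j<N. i \<noteq> j \<longrightarrow> \<pi> $$ (i, j) > 0) \<and> (\<forall>j<N. (\<Sum>i<N. \<pi> $$ (i, j)) = 0)}"

text \<open>
  The sum \<open>\<Sum>j. \<pi>\<^sub>j\<^sub>i P\<^sub>j\<close> is written entrywise because \<^typ>\<open>real mat\<close> has no
  dimension-independent zero matrix and hence is not an instance of \<^class>\<open>comm_monoid_add\<close>.
\<close>

definition coupling :: "nat \<Rightarrow> nat \<Rightarrow> real mat \<Rightarrow> (nat \<Rightarrow> real mat) \<Rightarrow> nat \<Rightarrow> real mat" where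
  "coupling n N \<pi> P i = mat n n (\<lambda>(r, c). \<Sum>j<N. \<pi> $$ (j, i) * P j $$ (r, c))"

definition lyapunov_lhs ::
    "nat \<Rightarrow> nat \<Rightarrow> (nat \<Rightarrow> real mat) \<Rightarrow> (nat \<Rightarrow> real mat) \<Rightarrow> real mat \<Rightarrow> real mat \<Rightarrow>
     nat \<Rightarrow> real mat \<Rightarrow> real mat \<Rightarrow> real mat" where
  "lyapunov_lhs n N K P Q \<pi> i A B =
     (A + B * K i)\<^sup>T * P i + P i * (A + B * K i) + coupling n N \<pi> P i + Q"

end

theory Submission
  imports "HOL-Analysis.Function_Topology" Defs
begin

text \<open>
  A solution of the second problem solves the first one after replacing \<open>Q\<close> by \<open>0\<close>.
  Conversely, the matrices \<open>Q\<close> and \<open>\<Pi>\<close> of a solution of the first problem can be perturbed to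
  \<open>Q + \<delta> I\<close> and \<open>\<Pi> + \<eta> (E - N I)\<close>, with \<open>E\<close> the all-ones matrix, once the strict inequality is known
  to hold with a uniform margin on each \<open>\<C>\<^sub>i\<close>. The set \<open>\<C>\<^sub>i\<close> may be unbounded, but it is invariant
  under adding any \<open>(D\<^sub>1, D\<^sub>2)\<close> with \<open>D\<^sub>1 X\<^sub>i + D\<^sub>2 U\<^sub>i = 0\<close>. Negative definiteness along all such lines
  forces \<open>D\<^sub>1 + D\<^sub>2 K\<^sub>i = 0\<close>. Hence \<open>A + B K\<^sub>i = (Xdot\<^sub>i - W) G\<close> for a fixed \<open>G\<close> built from a
  generalized inverse of the stacked data matrix, and the inequality depends on \<open>W\<close> only. The
  admissible \<open>W\<close> form a compact set because \<open>\<Phi>\<^sub>2\<^sub>2 \<prec> 0\<close>, which yields the margin.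
\<close>

section \<open>Generalized inverse of the stacked data matrix\<close>

text \<open>With \<open>Z\<close> the matrix of columns \<open>z c\<close> and \<open>H\<close> the
  matrix of rows \<open>h d\<close>, the equation says \<open>Z H Z = Z\<close>, so \<open>H\<close>
  is a generalized inverse of \<open>Z\<close>. It is built one column at a time: if the old rows
  already reproduce \<open>z T\<close>, a zero row is appended; otherwise they are corrected by a
  functional that separates \<open>z T\<close> from the earlier vectors.\<close>

lemma dual_frame_exists:
  fixes z :: "nat \<Rightarrow> 'a \<Rightarrow> real"
  assumes "finite I"
  shows "\<exists>h :: nat \<Rightarrow> 'a \<Rightarrow> real. \<forall>c<T. \<forall>i\<in>I. (\<Sum>d<T. (\<Sum>k\<in>I. h d k * z c k) * z d i) = z c i"
proof (induction T)
  case 0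
  show ?case by simp
next
  case (Suc T)
  then obtain h where h: "\<And>c i. c < T \<Longrightarrow> i \<in> I \<Longrightarrow> (\<Sum>d<T. (\<Sum>k\<in>I. h d k * z c k) * z d i) = z c i"
    by blast
  define ip where "ip f g = (\<Sum>k\<in>I. f k * g k)" for f g :: "'a \<Rightarrow> real"
  have ip_diff: "ip (\<lambda>k. f k - g k) u = ip f u - ip g u" for f g u
    unfolding ip_def by (simp add: algebra_simps sum_subtractf)
  have ip_scale: "ip (\<lambda>k. a * f k) u = a * ip f u" for a f u
    unfolding ip_def by (simp add: sum_distrib_left mult.assoc)
  have ip_sum: "ip (\<lambda>k. \<Sum>d<T. f d k) u = (\<Sum>d<T. ip (f d) u)" for f :: "nat \<Rightarrow> 'a \<Rightarrow> real" and u
    unfolding ip_def by (simp add: sum_distrib_right) (rule sum.swap)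
  have ip_comm: "ip f g = ip g f" for f g
    unfolding ip_def by (simp add: mult.commute)
  have ip_cong: "ip f u = ip g u" if "\<And>k. k \<in> I \<Longrightarrow> f k = g k" for f g u
    unfolding ip_def using that by (intro sum.cong) auto
  have h': "(\<Sum>d<T. ip (h d) (z c) * z d i) = z c i" if "c < T" "i \<in> I" for c i
    using h[OF that] by (simp add: ip_def)
  \<comment> \<open>The residual of \<open>z T\<close> after reconstruction from the earlier
    vectors; it vanishes on \<open>I\<close> exactly when the old rows reproduce
    \<open>z T\<close>.\<close>
  define r where "r i = z T i - (\<Sum>d<T. ip (h d) (z T) * z d i)" for i
  show ?case
  proof (cases "\<forall>i\<in>I. r i = 0")
    case True
    define g where "g = h(T := \<lambda>_. 0)"
    have g: "ip (g d) u = (if d = T then 0 else ip (h d) u)" for d u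
      by (simp add: g_def ip_def)
    have "(\<Sum>d<Suc T. ip (g d) (z c) * z d i) = z c i" if "c < Suc T" "i \<in> I" for c i
    proof -
      have "(\<Sum>d<Suc T. ip (g d) (z c) * z d i) = (\<Sum>d<T. ip (h d) (z c) * z d i)"
        by (simp add: g)
      also have "\<dots> = z c i"
        using that h' True by (cases "c = T") (auto simp: r_def)
      finally show ?thesis .
    qed
    then show ?thesis unfolding ip_def by blast
  next
    case False
    have rr: "ip r r \<noteq> 0"
    proof -
      obtain i where "i \<in> I" "r i \<noteq> 0" using False by blast
      then show ?thesis
        unfolding ip_def using assms by (subst sum_nonneg_eq_0_iff) auto
    qed
    \<comment> \<open>\<open>w\<close> is a functional that vanishes on the earlier vectors and equals \<open>1\<close> on \<open>z T\<close>.\<close>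
    define w where "w k = inverse (ip r r) * (r k - (\<Sum>d<T. ip (z d) r * h d k))" for k
    have w: "ip w u = inverse (ip r r) * ip (\<lambda>i. u i - (\<Sum>d<T. ip (h d) u * z d i)) r" for u
    proof -
      have "ip w u = inverse (ip r r) * (ip u r - (\<Sum>d<T. ip (z d) r * ip (h d) u))"
        unfolding w_def ip_scale ip_diff ip_sum ip_comm[of r u] ..
      then show ?thesis
        unfolding ip_diff ip_sum ip_scale by (simp add: mult.commute)
    qed
    have w0: "ip w (z c) = 0" if "c < T" for c
    proof -
      have "ip (\<lambda>i. z c i - (\<Sum>d<T. ip (h d) (z c) * z d i)) r = ip (\<lambda>i. 0 * r i) r"
        using h'[OF that] by (intro ip_cong) simp
      then show ?thesis unfolding w ip_scale by simp
    qed
    have w1: "ip w (z T) = 1"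
      using rr unfolding w r_def[symmetric] by simp
    \<comment> \<open>The corrected old rows vanish on \<open>z T\<close>, where only the new row
      \<open>w\<close> contributes. On the earlier vectors they agree with \<open>h\<close>, because
      \<open>w\<close> vanishes there.\<close>
    define g where "g = (\<lambda>d k. h d k - ip (h d) (z T) * w k)(T := w)"
    have g: "ip (g d) u = (if d = T then ip w u else ip (h d) u - ip (h d) (z T) * ip w u)" for d u
      by (simp add: g_def ip_diff ip_scale)
    have "(\<Sum>d<Suc T. ip (g d) (z c) * z d i) = z c i" if "c < Suc T" "i \<in> I" for c i
    proof -
      have "(\<Sum>d<Suc T. ip (g d) (z c) * z d i) =
          (\<Sum>d<T. ip (h d) (z c) * z d i) + ip w (z c) * r i"
        by (simp add: g r_def algebra_simps sum_subtractf sum_distrib_left)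
      also have "\<dots> = z c i"
        using that h' w0 w1 by (cases "c = T") (auto simp: r_def)
      finally show ?thesis .
    qed
    then show ?thesis unfolding ip_def by blast
  qed
qed

lemma index_mult_mat_sum:
  assumes "A \<in> carrier_mat nr k" "B \<in> carrier_mat k nc" "i < nr" "j < nc"
  shows "(A * B) $$ (i, j) = (\<Sum>d<k. A $$ (i, d) * B $$ (d, j))"
  using assms by (simp add: scalar_prod_def atLeast0LessThan)

text \<open>This is \<open>Z H Z = Z\<close> for \<open>Z\<close> the matrix \<open>X\<close>
  stacked on \<open>U\<close>, with \<open>H\<close> split into the column blocks \<open>H1\<close>
  and \<open>H2\<close>. The two equations are the row blocks of that identity.\<close>

lemma stacked_generalized_inverse_exists:
  fixes X U :: "real mat"
  assumes X: "X \<in> carrier_mat n T" and U: "U \<in> carrier_mat m T"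
  obtains H1 H2 where "H1 \<in> carrier_mat T n" "H2 \<in> carrier_mat T m"
    "X * (H1 * X + H2 * U) = X" "U * (H1 * X + H2 * U) = U"
proof -
  \<comment> \<open>Column \<open>c\<close> of the stacked matrix. Indexing its rows by a disjoint
    sum avoids offsets by \<open>n\<close>.\<close>
  define z where "z c = case_sum (\<lambda>k. X $$ (k, c)) (\<lambda>k. U $$ (k, c))" for c
  obtain h where h: "\<And>c i. c < T \<Longrightarrow> i \<in> {..<n} <+> {..<m} \<Longrightarrow>
      (\<Sum>d<T. (\<Sum>k\<in>{..<n} <+> {..<m}. h d k * z c k) * z d i) = z c i"
    using dual_frame_exists[of "{..<n} <+> {..<m}" T z] by auto
  define H1 where "H1 = mat T n (\<lambda>(d, k). h d (Inl k))"
  define H2 where "H2 = mat T m (\<lambda>(d, k). h d (Inr k))"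
  have H: "H1 \<in> carrier_mat T n" "H2 \<in> carrier_mat T m"
    by (auto simp: H1_def H2_def)
  have J: "(H1 * X + H2 * U) $$ (d, c) = (\<Sum>k\<in>{..<n} <+> {..<m}. h d k * z c k)"
    if "d < T" "c < T" for d c
    using that X U
    by (simp add: H1_def H2_def scalar_prod_def sum.Plus z_def atLeast0LessThan)
  have "X * (H1 * X + H2 * U) = X"
  proof (rule eq_matI)
    fix r c assume "r < dim_row X" "c < dim_col X"
    then have rc: "r < n" "c < T" using X by auto
    have "(X * (H1 * X + H2 * U)) $$ (r, c) = (\<Sum>d<T. X $$ (r, d) * (H1 * X + H2 * U) $$ (d, c))"
      using rc X U H by (intro index_mult_mat_sum) auto
    also have "\<dots> = (\<Sum>d<T. (\<Sum>k\<in>{..<n} <+> {..<m}. h d k * z c k) * z d (Inl r))"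
      using rc by (intro sum.cong) (simp_all add: J z_def mult.commute del: index_add_mat(1))
    also have "\<dots> = X $$ (r, c)"
      using h[of c "Inl r"] rc by (auto simp: z_def)
    finally show "(X * (H1 * X + H2 * U)) $$ (r, c) = X $$ (r, c)" .
  qed (use X U H in auto)
  moreover have "U * (H1 * X + H2 * U) = U"
  proof (rule eq_matI)
    fix r c assume "r < dim_row U" "c < dim_col U"
    then have rc: "r < m" "c < T" using U by auto
    have "(U * (H1 * X + H2 * U)) $$ (r, c) = (\<Sum>d<T. U $$ (r, d) * (H1 * X + H2 * U) $$ (d, c))"
      using rc X U H by (intro index_mult_mat_sum) auto
    also have "\<dots> = (\<Sum>d<T. (\<Sum>k\<in>{..<n} <+> {..<m}. h d k * z c k) * z d (Inr r))"
      using rc by (intro sum.cong) (simp_all add: J z_def mult.commute del: index_add_mat(1))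
    also have "\<dots> = U $$ (r, c)"
      using h[of c "Inr r"] rc by (auto simp: z_def)
    finally show "(U * (H1 * X + H2 * U)) $$ (r, c) = U $$ (r, c)" .
  qed (use X U H in auto)
  ultimately show ?thesis using H that by blast
qed

section \<open>Continuity and compactness for quadratic forms\<close>

text \<open>Tychonoff's theorem. Vectors and matrices are parametrized below by real functions with
  the product topology, and this box is the ambient compact set for both.\<close>

lemma compact_box: "compact {f :: 'a \<Rightarrow> real. \<forall>x. f x \<in> {a..b}}"
proof -
  have "compactin (product_topology (\<lambda>_. euclidean) UNIV) (PiE UNIV (\<lambda>_ :: 'a. {a..b :: real}))"
    by (subst compactin_PiE) simp
  then show ?thesis
    by (simp add: euclidean_product_topology PiE_def Pi_def)
qed

lemma scalar_prod_mult_mat_vec: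
  fixes M :: "real mat"
  assumes "M \<in> carrier_mat n k" "u \<in> carrier_vec n" "v \<in> carrier_vec k"
  shows "u \<bullet> (M *\<^sub>v v) = (\<Sum>i<n. \<Sum>j<k. u $ i * M $$ (i, j) * v $ j)"
  using assms by (simp add: scalar_prod_def atLeast0LessThan sum_distrib_left mult.assoc)

text \<open>Continuity is expressed through the entries, which are real-valued, and the fixed
  dimensions are part of the notion so that products expand into sums of fixed length.\<close>

definition entrywise_continuous :: "nat \<Rightarrow> nat \<Rightarrow> ('a :: topological_space \<Rightarrow> real mat) \<Rightarrow> bool" where
  "entrywise_continuous nr nc F \<longleftrightarrow>
     (\<forall>s. F s \<in> carrier_mat nr nc) \<and> (\<forall>i<nr. \<forall>j<nc. continuous_on UNIV (\<lambda>s. F s $$ (i, j)))"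

lemma entrywise_continuous_const: "M \<in> carrier_mat nr nc \<Longrightarrow> entrywise_continuous nr nc (\<lambda>_. M)"
  by (simp add: entrywise_continuous_def)

lemma entrywise_continuous_mat: "entrywise_continuous nr nc (\<lambda>w. mat nr nc w)"
  by (simp add: entrywise_continuous_def)

lemma entrywise_continuous_transpose:
  assumes "entrywise_continuous nr nc F"
  shows "entrywise_continuous nc nr (\<lambda>s. (F s)\<^sup>T)"
  unfolding entrywise_continuous_def
proof (intro conjI allI impI)
  have F: "F s \<in> carrier_mat nr nc" for s
    using assms by (auto simp: entrywise_continuous_def)
  show "(F s)\<^sup>T \<in> carrier_mat nc nr" for s
    using F[of s] by simp
  fix i j assume ij: "i < nc" "j < nr"
  have "(F s)\<^sup>T $$ (i, j) = F s $$ (j, i)" for s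
    using F[of s] ij by simp
  then show "continuous_on UNIV (\<lambda>s. (F s)\<^sup>T $$ (i, j))"
    using assms ij by (simp add: entrywise_continuous_def)
qed

lemma entrywise_continuous_add:
  assumes "entrywise_continuous nr nc F" "entrywise_continuous nr nc G"
  shows "entrywise_continuous nr nc (\<lambda>s. F s + G s)"
  unfolding entrywise_continuous_def
proof (intro conjI allI impI)
  have FG: "F s \<in> carrier_mat nr nc" "G s \<in> carrier_mat nr nc" for s
    using assms by (auto simp: entrywise_continuous_def)
  show "F s + G s \<in> carrier_mat nr nc" for s
    using FG[of s] by auto
  fix i j assume ij: "i < nr" "j < nc"
  have "(F s + G s) $$ (i, j) = F s $$ (i, j) + G s $$ (i, j)" for s
    using FG[of s] ij by auto
  then show "continuous_on UNIV (\<lambda>s. (F s + G s) $$ (i, j))"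
    using assms ij by (simp add: entrywise_continuous_def continuous_on_add)
qed

lemma entrywise_continuous_minus:
  assumes "entrywise_continuous nr nc F" "entrywise_continuous nr nc G"
  shows "entrywise_continuous nr nc (\<lambda>s. F s - G s)"
  unfolding entrywise_continuous_def
proof (intro conjI allI impI)
  have FG: "F s \<in> carrier_mat nr nc" "G s \<in> carrier_mat nr nc" for s
    using assms by (auto simp: entrywise_continuous_def)
  show "F s - G s \<in> carrier_mat nr nc" for s
    using FG[of s] by auto
  fix i j assume ij: "i < nr" "j < nc"
  have "(F s - G s) $$ (i, j) = F s $$ (i, j) - G s $$ (i, j)" for s
    using FG[of s] ij by auto
  then show "continuous_on UNIV (\<lambda>s. (F s - G s) $$ (i, j))"
    using assms ij by (simp add: entrywise_continuous_def continuous_on_diff)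
qed

lemma entrywise_continuous_mult:
  assumes "entrywise_continuous nr k F" "entrywise_continuous k nc G"
  shows "entrywise_continuous nr nc (\<lambda>s. F s * G s)"
  unfolding entrywise_continuous_def
proof (intro conjI allI impI)
  have FG: "F s \<in> carrier_mat nr k" "G s \<in> carrier_mat k nc" for s
    using assms by (auto simp: entrywise_continuous_def)
  show "F s * G s \<in> carrier_mat nr nc" for s
    using FG[of s] by auto
  fix i j assume ij: "i < nr" "j < nc"
  have "continuous_on UNIV (\<lambda>s. \<Sum>d<k. F s $$ (i, d) * G s $$ (d, j))"
    using assms ij
    by (intro continuous_on_sum continuous_on_mult) (auto simp: entrywise_continuous_def)
  then show "continuous_on UNIV (\<lambda>s. (F s * G s) $$ (i, j))"
    using ij by (simp only: index_mult_mat_sum[OF FG])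
qed

lemma entrywise_continuous_append_rows:
  assumes "entrywise_continuous k nc F" "entrywise_continuous l nc G"
  shows "entrywise_continuous (k + l) nc (\<lambda>s. F s @\<^sub>r G s)"
  unfolding entrywise_continuous_def
proof (intro conjI allI impI)
  have FG: "F s \<in> carrier_mat k nc" "G s \<in> carrier_mat l nc" for s
    using assms by (auto simp: entrywise_continuous_def)
  show "F s @\<^sub>r G s \<in> carrier_mat (k + l) nc" for s
    using FG[of s] by (rule carrier_append_rows)
  fix i j assume ij: "i < k + l" "j < nc"
  have "(F s @\<^sub>r G s) $$ (i, j) = (if i < k then F s $$ (i, j) else G s $$ (i - k, j))" for s
    using FG[of s] ij by (auto simp: append_rows_def)
  then show "continuous_on UNIV (\<lambda>s. (F s @\<^sub>r G s) $$ (i, j))"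
    using assms ij by (cases "i < k") (simp_all add: entrywise_continuous_def)
qed

lemma continuous_on_quadratic_form:
  assumes "entrywise_continuous n n F" "v \<in> carrier_vec n"
  shows "continuous_on UNIV (\<lambda>s. v \<bullet> (F s *\<^sub>v v))"
proof -
  have eq: "(\<lambda>s. v \<bullet> (F s *\<^sub>v v)) = (\<lambda>s. \<Sum>i<n. \<Sum>j<n. v $ i * F s $$ (i, j) * v $ j)"
    using assms by (intro ext scalar_prod_mult_mat_vec) (auto simp: entrywise_continuous_def)
  show ?thesis
    unfolding eq using assms
    by (intro continuous_on_sum continuous_on_mult continuous_on_const)
      (auto simp: entrywise_continuous_def)
qed

lemma scalar_prod_self_pos:
  fixes v :: "real vec"
  assumes "v \<in> carrier_vec n" "v \<noteq> 0\<^sub>v n"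
  shows "0 < v \<bullet> v"
proof -
  obtain k where k: "k < n" "v $ k \<noteq> 0"
    using assms by (metis eq_vecI carrier_vecD index_zero_vec)
  have "v \<bullet> v = (\<Sum>i<n. (v $ i)\<^sup>2)"
    using assms by (simp add: scalar_prod_def atLeast0LessThan power2_eq_square)
  also have "0 < \<dots>"
    using k by (intro sum_pos2[of _ k]) auto
  finally show ?thesis .
qed

text \<open>\<open>C\<close> is the maximum of the form over \<open>S\<close> times the unit sphere,
  carried over to all vectors by homogeneity. Since the maximum is attained, it is negative as soon
  as the form is; this gives the second clause.\<close>

lemma quadratic_form_bounded_on_compact:
  fixes F :: "'a :: topological_space \<Rightarrow> real mat"
  assumes S: "compact S" and F: "entrywise_continuous n n F"
  obtains C where
    "\<And>s v. s \<in> S \<Longrightarrow> v \<in> carrier_vec n \<Longrightarrow> v \<bullet> (F s *\<^sub>v v) \<le> C * (v \<bullet> v)"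
    "(\<And>s v. s \<in> S \<Longrightarrow> v \<in> carrier_vec n \<Longrightarrow> v \<noteq> 0\<^sub>v n \<Longrightarrow> v \<bullet> (F s *\<^sub>v v) < 0) \<Longrightarrow> C < 0"
proof -
  \<comment> \<open>The unit sphere of dimension \<open>n\<close>, in terms of functions on all
    naturals. Coordinates from \<open>n\<close> on are free in the interval, which keeps
    \<open>B\<close> compact and does not affect the form.\<close>
  define B where "B = {f :: nat \<Rightarrow> real. \<forall>x. f x \<in> {-1..1}} \<inter> {f. (\<Sum>i<n. (f i)\<^sup>2) = 1}"
  have "closed {f :: nat \<Rightarrow> real. (\<Sum>i<n. (f i)\<^sup>2) = 1}"
    by (intro closed_Collect_eq continuous_intros continuous_on_product_coordinates)
  then have B: "compact B"
    unfolding B_def by (intro compact_Int_closed compact_box)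
  define q where "q p = (\<Sum>i<n. \<Sum>j<n. snd p i * F (fst p) $$ (i, j) * snd p j)" for p :: "'a \<times> (nat \<Rightarrow> real)"
  have F_carrier: "F s \<in> carrier_mat n n" for s
    using F by (simp add: entrywise_continuous_def)
  have q: "q (s, f) = vec n f \<bullet> (F s *\<^sub>v vec n f)" for s f
    by (simp add: q_def scalar_prod_mult_mat_vec[OF F_carrier])
  have coord: "continuous_on UNIV (\<lambda>p :: 'a \<times> (nat \<Rightarrow> real). snd p i)" for i
    using continuous_on_product_then_coordinatewise[OF continuous_on_snd[OF continuous_on_id]] .
  have entry: "continuous_on UNIV (\<lambda>p :: 'a \<times> (nat \<Rightarrow> real). F (fst p) $$ (i, j))" if "i < n" "j < n" for i j
  proof (rule continuous_on_compose2[of UNIV "\<lambda>s. F s $$ (i, j)" UNIV fst])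
    show "continuous_on UNIV (\<lambda>s. F s $$ (i, j))"
      using F that by (simp add: entrywise_continuous_def)
  qed (auto intro: continuous_intros)
  have "continuous_on UNIV q"
    unfolding q_def by (intro continuous_intros coord entry) auto
  then have q_cont: "continuous_on (S \<times> B) q"
    by (rule continuous_on_subset) simp
  obtain C where C: "\<And>s f. s \<in> S \<Longrightarrow> f \<in> B \<Longrightarrow> q (s, f) \<le> C"
      "(\<And>s f. s \<in> S \<Longrightarrow> f \<in> B \<Longrightarrow> q (s, f) < 0) \<Longrightarrow> C < 0"
  proof (cases "S \<times> B = {}")
    case True
    \<comment> \<open>If \<open>S\<close> is empty or \<open>n = 0\<close> there is nothing to
      maximize, and any negative constant works.\<close>
    then show ?thesis using that[of "-1"] by auto
  next
    case False
    with continuous_attains_sup[OF compact_Times[OF S B] _ q_cont]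
    obtain p where "p \<in> S \<times> B" "\<And>p'. p' \<in> S \<times> B \<Longrightarrow> q p' \<le> q p" by blast
    then show ?thesis using that[of "q p"] by auto
  qed
  show ?thesis
  proof (rule that[of C])
    fix s and v :: "real vec" assume sv: "s \<in> S" "v \<in> carrier_vec n"
    show "v \<bullet> (F s *\<^sub>v v) \<le> C * (v \<bullet> v)"
    proof (cases "v = 0\<^sub>v n")
      case True
      then show ?thesis using F_carrier[of s] by simp
    next
      case False
      define r where "r = sqrt (v \<bullet> v)"
      have vv: "v \<bullet> v = (\<Sum>i<n. (v $ i)\<^sup>2)"
        using sv by (simp add: scalar_prod_def atLeast0LessThan power2_eq_square)
      have pos: "v \<bullet> v > 0"
        using scalar_prod_self_pos sv(2) False by blast
      then have r: "r > 0" "r\<^sup>2 = v \<bullet> v" by (auto simp: r_def)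
      define f where "f i = (if i < n then v $ i / r else 0)" for i
      have sum_f: "(\<Sum>i<n. (f i)\<^sup>2) = 1"
        using r pos by (simp add: f_def power_divide flip: sum_divide_distrib vv)
      have "f i \<in> {-1..1}" for i
      proof -
        have "(f i)\<^sup>2 \<le> 1"
        proof (cases "i < n")
          case True
          then have "(f i)\<^sup>2 \<le> (\<Sum>i<n. (f i)\<^sup>2)" by (intro member_le_sum) auto
          then show ?thesis by (simp add: sum_f)
        qed (simp add: f_def)
        then show ?thesis by (simp add: abs_square_le_1 abs_le_iff)
      qed
      then have "f \<in> B" using sum_f by (simp add: B_def)
      then have "q (s, f) \<le> C" using C sv by blast
      moreover have "q (s, f) = (v \<bullet> (F s *\<^sub>v v)) / r\<^sup>2"
        using sv
        by (simp add: q_def f_def scalar_prod_mult_mat_vec[OF F_carrier] sum_divide_distrib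
            power2_eq_square)
      ultimately show ?thesis using r pos by (simp add: field_simps)
    qed
  next
    assume neg: "\<And>s v. s \<in> S \<Longrightarrow> v \<in> carrier_vec n \<Longrightarrow> v \<noteq> 0\<^sub>v n \<Longrightarrow> v \<bullet> (F s *\<^sub>v v) < 0"
    show "C < 0"
    proof (rule C(2))
      fix s f assume "s \<in> S" "f \<in> B"
      moreover have "vec n f \<noteq> 0\<^sub>v n"
      proof
        assume "vec n f = 0\<^sub>v n"
        then have "f i = 0" if "i < n" for i
          using that by (metis index_vec index_zero_vec(1))
        then show False using \<open>f \<in> B\<close> by (simp add: B_def)
      qed
      ultimately show "q (s, f) < 0" by (simp add: q neg)
    qed
  qed
qed

text \<open>A single matrix is a constant family over a one-point parameter space.\<close>

lemma quadratic_form_bounded: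
  fixes M :: "real mat"
  assumes "M \<in> carrier_mat n n"
  obtains C where
    "\<And>v. v \<in> carrier_vec n \<Longrightarrow> v \<bullet> (M *\<^sub>v v) \<le> C * (v \<bullet> v)"
    "(\<And>v. v \<in> carrier_vec n \<Longrightarrow> v \<noteq> 0\<^sub>v n \<Longrightarrow> v \<bullet> (M *\<^sub>v v) < 0) \<Longrightarrow> C < 0"
proof -
  have "compact {0 :: nat}" by simp
  from quadratic_form_bounded_on_compact[OF this entrywise_continuous_const[OF assms]]
  show ?thesis using that by (metis singletonI)
qed

lemma closed_mat_eq:
  assumes F: "entrywise_continuous nr nc F" and G: "entrywise_continuous nr nc G"
  shows "closed {s. F s = G s}"
proof -
  have FG: "F s \<in> carrier_mat nr nc" "G s \<in> carrier_mat nr nc" for s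
    using F G by (auto simp: entrywise_continuous_def)
  have "{s. F s = G s} = (\<Inter>i\<in>{..<nr}. \<Inter>j\<in>{..<nc}. {s. F s $$ (i, j) = G s $$ (i, j)})"
  proof (intro Set.set_eqI iffI)
    fix s assume "s \<in> (\<Inter>i\<in>{..<nr}. \<Inter>j\<in>{..<nc}. {s. F s $$ (i, j) = G s $$ (i, j)})"
    then have "F s = G s"
      using FG[of s] by (intro eq_matI) auto
    then show "s \<in> {s. F s = G s}" by simp
  qed auto
  moreover have "closed {s. F s $$ (i, j) = G s $$ (i, j)}" if "i < nr" "j < nc" for i j
    using F G that by (intro closed_Collect_eq) (auto simp: entrywise_continuous_def)
  ultimately show ?thesis by (simp add: closed_INT)
qed

section \<open>Closedness and boundedness of the noise set\<close>

text \<open>The symmetry contained in \<open>pos_semidef\<close> is automatic for a congruence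
  transform of the symmetric \<open>\<Phi>\<close>. What remains is a family of scalar inequalities,
  which are closed conditions on \<open>W\<close>.\<close>

lemma noise_set_iff:
  assumes \<Phi>: "symmetric_mat (n + T) \<Phi>" and W: "W \<in> carrier_mat n T"
  shows "W \<in> noise_set n T \<Phi> \<longleftrightarrow> (\<forall>v\<in>carrier_vec n.
    0 \<le> v \<bullet> (((1\<^sub>m n @\<^sub>r W\<^sup>T)\<^sup>T * \<Phi> * (1\<^sub>m n @\<^sub>r W\<^sup>T)) *\<^sub>v v))"
proof -
  let ?E = "1\<^sub>m n @\<^sub>r W\<^sup>T"
  have E: "?E \<in> carrier_mat (n + T) n" using W by auto
  have P: "\<Phi> \<in> carrier_mat (n + T) (n + T)" "\<Phi>\<^sup>T = \<Phi>"
    using \<Phi> by (auto simp: symmetric_mat_def)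
  have EP: "?E\<^sup>T * \<Phi> \<in> carrier_mat n (n + T)" using E P by auto
  have "(?E\<^sup>T * \<Phi> * ?E)\<^sup>T = ?E\<^sup>T * (\<Phi> * ?E)"
    unfolding transpose_mult[OF EP E] transpose_mult[OF transpose_carrier_mat[THEN iffD2, OF E] P(1)]
    using P by simp
  also have "\<dots> = ?E\<^sup>T * \<Phi> * ?E"
    by (rule assoc_mult_mat[OF _ P(1) E, symmetric]) (use E in auto)
  finally have "symmetric_mat n (?E\<^sup>T * \<Phi> * ?E)"
    using E EP by (auto simp: symmetric_mat_def)
  then show ?thesis using W by (simp add: noise_set_def pos_semidef_def)
qed

lemma closed_noise_set:
  assumes \<Phi>: "symmetric_mat (n + T) \<Phi>"
  shows "closed {w. mat n T w \<in> noise_set n T \<Phi>}"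
proof -
  define F where "F w = (1\<^sub>m n @\<^sub>r (mat n T w)\<^sup>T)\<^sup>T * \<Phi> * (1\<^sub>m n @\<^sub>r (mat n T w)\<^sup>T)" for w
  have F: "entrywise_continuous n n F"
  proof -
    have "entrywise_continuous (n + T) n (\<lambda>w. 1\<^sub>m n @\<^sub>r (mat n T w)\<^sup>T)"
      by (intro entrywise_continuous_append_rows entrywise_continuous_transpose
          entrywise_continuous_mat entrywise_continuous_const one_carrier_mat)
    moreover have "entrywise_continuous (n + T) (n + T) (\<lambda>w :: nat \<times> nat \<Rightarrow> real. \<Phi>)"
      using \<Phi> by (intro entrywise_continuous_const) (simp add: symmetric_mat_def)
    ultimately show ?thesis
      unfolding F_def by (intro entrywise_continuous_mult entrywise_continuous_transpose)
  qed
  have "{w. mat n T w \<in> noise_set n T \<Phi>} = (\<Inter>v\<in>carrier_vec n. {w. 0 \<le> v \<bullet> (F w *\<^sub>v v)})"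
    by (auto simp: noise_set_iff[OF \<Phi>] F_def)
  moreover have "closed {w. 0 \<le> v \<bullet> (F w *\<^sub>v v)}" if "v \<in> carrier_vec n" for v
    using continuous_on_quadratic_form[OF F that] by (intro closed_Collect_le) auto
  ultimately show ?thesis by (simp add: closed_INT)
qed

lemma congruence_quadratic_form:
  fixes E M :: "real mat"
  assumes E: "E \<in> carrier_mat k n" and M: "M \<in> carrier_mat k k" and v: "v \<in> carrier_vec n"
  shows "v \<bullet> ((E\<^sup>T * M * E) *\<^sub>v v) = (E *\<^sub>v v) \<bullet> (M *\<^sub>v (E *\<^sub>v v))"
proof -
  have c: "E\<^sup>T \<in> carrier_mat n k" "E\<^sup>T * M \<in> carrier_mat n k" "E *\<^sub>v v \<in> carrier_vec k"
    using assms by auto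
  have "(E\<^sup>T * M * E) *\<^sub>v v = E\<^sup>T *\<^sub>v (M *\<^sub>v (E *\<^sub>v v))"
    unfolding assoc_mult_mat_vec[OF c(2) E v] assoc_mult_mat_vec[OF c(1) M c(3)] ..
  moreover have "(E *\<^sub>v v) \<bullet> (M *\<^sub>v (E *\<^sub>v v)) = v \<bullet> (E\<^sup>T *\<^sub>v (M *\<^sub>v (E *\<^sub>v v)))"
    using transpose_vec_mult_scalar[OF c(1) _ v, of "M *\<^sub>v (E *\<^sub>v v)"] c(3) M by simp
  ultimately show ?thesis by simp
qed

lemma four_block_quadratic_form:
  fixes A B D :: "real mat"
  assumes A: "A \<in> carrier_mat n n" and B: "B \<in> carrier_mat n k" and D: "D \<in> carrier_mat k k"
    and x: "x \<in> carrier_vec n" and y: "y \<in> carrier_vec k"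
  shows "(x @\<^sub>v y) \<bullet> (four_block_mat A B B\<^sup>T D *\<^sub>v (x @\<^sub>v y)) =
    x \<bullet> (A *\<^sub>v x) + 2 * ((B\<^sup>T *\<^sub>v x) \<bullet> y) + y \<bullet> (D *\<^sub>v y)"
proof -
  have BT: "B\<^sup>T \<in> carrier_mat k n" using B by simp
  have c: "A *\<^sub>v x \<in> carrier_vec n" "B *\<^sub>v y \<in> carrier_vec n"
      "B\<^sup>T *\<^sub>v x \<in> carrier_vec k" "D *\<^sub>v y \<in> carrier_vec k"
    using A B BT D x y by (meson mult_mat_vec_carrier)+
  have "(x @\<^sub>v y) \<bullet> (four_block_mat A B B\<^sup>T D *\<^sub>v (x @\<^sub>v y)) =
      x \<bullet> (A *\<^sub>v x + B *\<^sub>v y) + y \<bullet> (B\<^sup>T *\<^sub>v x + D *\<^sub>v y)"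
    unfolding four_block_mat_mult_vec[OF A B BT D x y]
    using c x y by (intro scalar_prod_append) auto
  also have "\<dots> = x \<bullet> (A *\<^sub>v x) + x \<bullet> (B *\<^sub>v y) + (y \<bullet> (B\<^sup>T *\<^sub>v x) + y \<bullet> (D *\<^sub>v y))"
    using c x y by (simp add: scalar_prod_add_distrib[of _ n] scalar_prod_add_distrib[of _ k])
  also have "x \<bullet> (B *\<^sub>v y) = (B\<^sup>T *\<^sub>v x) \<bullet> y"
    using transpose_vec_mult_scalar[OF B y x] by simp
  also have "y \<bullet> (B\<^sup>T *\<^sub>v x) = (B\<^sup>T *\<^sub>v x) \<bullet> y"
    using c y by (intro comm_scalar_prod[of _ k]) auto
  finally show ?thesis by simp
qed

text \<open>Testing the defining inequality with the \<open>i\<close>-th unit vector bounds row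
  \<open>i\<close> of \<open>W\<close>: the form of \<open>\<Phi>22\<close> dominates the linear
  term with a negative sign. The fact \<open>0 \<le> r\<close> is recorded so that zero padding of
  \<open>W\<close> stays in the box.\<close>

lemma noise_set_bounded:
  assumes blocks: "\<Phi>11 \<in> carrier_mat n n" "\<Phi>12 \<in> carrier_mat n T" "\<Phi>22 \<in> carrier_mat T T"
    and \<Phi>_eq: "\<Phi> = four_block_mat \<Phi>11 \<Phi>12 \<Phi>12\<^sup>T \<Phi>22"
    and \<Phi>: "symmetric_mat (n + T) \<Phi>" and neg: "neg_def T \<Phi>22"
  obtains r where
    "\<And>W i j. W \<in> noise_set n T \<Phi> \<Longrightarrow> i < n \<Longrightarrow> j < T \<Longrightarrow> W $$ (i, j) \<in> {-r..r}" "0 \<le> r"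
proof -
  obtain c where c: "\<And>y. y \<in> carrier_vec T \<Longrightarrow> y \<bullet> (\<Phi>22 *\<^sub>v y) \<le> - c * (y \<bullet> y)" "c > 0"
  proof -
    obtain C where
      "\<And>v. v \<in> carrier_vec T \<Longrightarrow> v \<bullet> (\<Phi>22 *\<^sub>v v) \<le> C * (v \<bullet> v)"
      "(\<And>v. v \<in> carrier_vec T \<Longrightarrow> v \<noteq> 0\<^sub>v T \<Longrightarrow> v \<bullet> (\<Phi>22 *\<^sub>v v) < 0) \<Longrightarrow> C < 0"
      using quadratic_form_bounded[OF blocks(3)] by blast
    then show ?thesis using neg that[of "- C"] by (simp add: neg_def_def)
  qed
  define b where "b i = \<Phi>12\<^sup>T *\<^sub>v unit_vec n i" for i
  \<comment> \<open>The bound on the squared norm of row \<open>i\<close> that is left after half of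
    the term \<open>c * (y \<bullet> y)\<close> has absorbed the linear term.\<close>
  define D where "D i = 2 / c * (unit_vec n i \<bullet> (\<Phi>11 *\<^sub>v unit_vec n i) + 2 / c * (b i \<bullet> b i))" for i
  have b: "b i \<in> carrier_vec T" for i
    unfolding b_def using blocks by auto
  have sq: "(W $$ (i, j))\<^sup>2 \<le> D i" if W: "W \<in> noise_set n T \<Phi>" and ij: "i < n" "j < T" for W i j
  proof -
    let ?e = "unit_vec n i :: real vec" and ?E = "1\<^sub>m n @\<^sub>r W\<^sup>T"
    define y where "y = row W i"
    have Wc: "W \<in> carrier_mat n T" using W by (simp add: noise_set_def)
    have y: "y \<in> carrier_vec T" "y = W\<^sup>T *\<^sub>v ?e"
      unfolding y_def using Wc ij by auto
    have E: "?E \<in> carrier_mat (n + T) n" using Wc by auto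
    have Ee: "?E *\<^sub>v ?e = ?e @\<^sub>v y"
      unfolding y(2) using mat_mult_append[of "1\<^sub>m n" n n "W\<^sup>T" T ?e] Wc by simp
    have \<Phi>c: "\<Phi> \<in> carrier_mat (n + T) (n + T)" using \<Phi> by (simp add: symmetric_mat_def)
    have "0 \<le> ?e \<bullet> ((?E\<^sup>T * \<Phi> * ?E) *\<^sub>v ?e)"
      using W noise_set_iff[OF \<Phi> Wc] by auto
    also have "\<dots> = (?E *\<^sub>v ?e) \<bullet> (\<Phi> *\<^sub>v (?E *\<^sub>v ?e))"
      by (rule congruence_quadratic_form[OF E \<Phi>c]) simp
    also have "\<dots> = ?e \<bullet> (\<Phi>11 *\<^sub>v ?e) + 2 * (b i \<bullet> y) + y \<bullet> (\<Phi>22 *\<^sub>v y)"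
      unfolding Ee \<Phi>_eq b_def using blocks y(1) by (intro four_block_quadratic_form) auto
    also have "\<dots> \<le> ?e \<bullet> (\<Phi>11 *\<^sub>v ?e) + 2 * (b i \<bullet> y) - c * (y \<bullet> y)"
      using c(1)[OF y(1)] by simp
    \<comment> \<open>Young's inequality, weighted so that exactly half of the negative quadratic
      term survives.\<close>
    also have "2 * (b i \<bullet> y) \<le> 2 / c * (b i \<bullet> b i) + c / 2 * (y \<bullet> y)"
    proof -
      have "2 * (b i $ k * y $ k) \<le> 2 / c * (b i $ k * b i $ k) + c / 2 * (y $ k * y $ k)" for k
      proof -
        have "0 \<le> (2 * b i $ k - c * y $ k)\<^sup>2 / (2 * c)" using c(2) by simp
        then show ?thesis using c(2) by (simp add: power2_eq_square field_simps)
      qed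
      then show ?thesis
        using b[of i] y(1)
        by (simp add: scalar_prod_def sum_distrib_left sum_mono flip: sum.distrib)
    qed
    finally have "c / 2 * (y \<bullet> y) \<le> ?e \<bullet> (\<Phi>11 *\<^sub>v ?e) + 2 / c * (b i \<bullet> b i)" by simp
    then have "y \<bullet> y \<le> D i" unfolding D_def using c(2) by (simp add: field_simps)
    moreover have "(W $$ (i, j))\<^sup>2 \<le> y \<bullet> y"
    proof -
      have "(y $ j)\<^sup>2 \<le> (\<Sum>k<T. (y $ k)\<^sup>2)" using ij by (intro member_le_sum) auto
      then show ?thesis using y(1) Wc ij
        by (simp add: scalar_prod_def atLeast0LessThan power2_eq_square y_def)
    qed
    ultimately show ?thesis by simp
  qed
  \<comment> \<open>One radius for all rows; an absolute value is at most one plus its square, so no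
    square root is taken.\<close>
  define r where "r = (\<Sum>i<n. 1 + \<bar>D i\<bar>)"
  show ?thesis
  proof (rule that[of r])
    fix W i j assume a: "W \<in> noise_set n T \<Phi>" "i < n" "j < T"
    have "\<bar>W $$ (i, j)\<bar> \<le> 1 + (W $$ (i, j))\<^sup>2"
      using zero_le_power2[of "\<bar>W $$ (i, j)\<bar> - 1"] by (simp add: power2_diff)
    also have "\<dots> \<le> 1 + \<bar>D i\<bar>" using sq[OF a] by simp
    also have "\<dots> \<le> r" unfolding r_def using a by (intro member_le_sum) auto
    finally show "W $$ (i, j) \<in> {-r..r}" by auto
  qed (auto simp: r_def intro: sum_nonneg)
qed

section \<open>System pairs that the data cannot distinguish\<close>

lemma lyapunov_quadratic_form:
  fixes M P :: "real mat"
  assumes M: "M \<in> carrier_mat n n" and P: "symmetric_mat n P" and v: "v \<in> carrier_vec n"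
  shows "v \<bullet> ((M\<^sup>T * P + P * M) *\<^sub>v v) = 2 * ((M *\<^sub>v v) \<bullet> (P *\<^sub>v v))"
proof -
  have Pc: "P \<in> carrier_mat n n" "P\<^sup>T = P" using P by (auto simp: symmetric_mat_def)
  have MT: "M\<^sup>T \<in> carrier_mat n n" using M by simp
  have c: "M *\<^sub>v v \<in> carrier_vec n" "P *\<^sub>v v \<in> carrier_vec n"
    using M Pc v by auto
  have c': "M\<^sup>T *\<^sub>v (P *\<^sub>v v) \<in> carrier_vec n" "P *\<^sub>v (M *\<^sub>v v) \<in> carrier_vec n"
    using M Pc c by auto
  have "(M\<^sup>T * P + P * M) *\<^sub>v v = M\<^sup>T *\<^sub>v (P *\<^sub>v v) + P *\<^sub>v (M *\<^sub>v v)"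
    using M MT Pc(1) v
    by (simp add: add_mult_distrib_mat_vec[of _ n n] assoc_mult_mat_vec[of _ n n _ n])
  then have "v \<bullet> ((M\<^sup>T * P + P * M) *\<^sub>v v) = v \<bullet> (M\<^sup>T *\<^sub>v (P *\<^sub>v v)) + v \<bullet> (P *\<^sub>v (M *\<^sub>v v))"
    using scalar_prod_add_distrib[OF v c'] by simp
  also have "v \<bullet> (M\<^sup>T *\<^sub>v (P *\<^sub>v v)) = (M *\<^sub>v v) \<bullet> (P *\<^sub>v v)"
    using transpose_vec_mult_scalar[OF MT c(2) v] by simp
  also have "v \<bullet> (P *\<^sub>v (M *\<^sub>v v)) = (P *\<^sub>v v) \<bullet> (M *\<^sub>v v)"
    using transpose_vec_mult_scalar[OF Pc(1) c(1) v] Pc(2) by simp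
  also have "\<dots> = (M *\<^sub>v v) \<bullet> (P *\<^sub>v v)"
    using c by (intro comm_scalar_prod[of _ n]) auto
  finally show ?thesis by simp
qed

text \<open>The pair \<open>(A0 + M * D1, B0 + M * D2)\<close> produces the same data for every
  \<open>M\<close>, while its closed loop differs from the original one by
  \<open>M * (D1 + D2 * K)\<close>. Were this factor nonzero, a suitable \<open>M\<close> would
  bring the form at some nonzero vector to \<open>0\<close>.\<close>

lemma closed_loop_vanishes_on_kernel:
  fixes A0 B0 D1 D2 X U P K R :: "real mat"
  assumes A0: "A0 \<in> carrier_mat n n" and B0: "B0 \<in> carrier_mat n m"
    and D1: "D1 \<in> carrier_mat n n" and D2: "D2 \<in> carrier_mat n m"
    and X: "X \<in> carrier_mat n T" and U: "U \<in> carrier_mat m T"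
    and K: "K \<in> carrier_mat m n" and R: "R \<in> carrier_mat n n" and P: "pos_def n P"
    and kernel: "D1 * X + D2 * U = 0\<^sub>m n T"
    and neg: "\<And>A B v. A \<in> carrier_mat n n \<Longrightarrow> B \<in> carrier_mat n m \<Longrightarrow>
      A * X + B * U = A0 * X + B0 * U \<Longrightarrow> v \<in> carrier_vec n \<Longrightarrow> v \<noteq> 0\<^sub>v n \<Longrightarrow>
      v \<bullet> (((A + B * K)\<^sup>T * P + P * (A + B * K) + R) *\<^sub>v v) < 0"
  shows "D1 + D2 * K = 0\<^sub>m n n"
proof (rule ccontr)
  define D where "D = D1 + D2 * K"
  have D: "D \<in> carrier_mat n n" using D1 D2 K by (auto simp: D_def)
  assume "D1 + D2 * K \<noteq> 0\<^sub>m n n"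
  then have "D \<noteq> 0\<^sub>m n n" by (simp add: D_def)
  then obtain i j where ij: "i < n" "j < n" "D $$ (i, j) \<noteq> 0"
    using D by (metis carrier_matD eq_matI index_zero_mat)
  define v where "v = (unit_vec n j :: real vec)"
  define w where "w = D *\<^sub>v v"
  have v: "v \<in> carrier_vec n" "v \<noteq> 0\<^sub>v n" using ij by (auto simp: v_def)
  have "w $ i = D $$ (i, j)" using D ij by (simp add: w_def v_def)
  then have "w \<noteq> 0\<^sub>v n" using ij by auto
  moreover have "w \<in> carrier_vec n" using D v by (auto simp: w_def)
  ultimately have w: "w \<in> carrier_vec n" "w \<noteq> 0\<^sub>v n" by auto
  have Ps: "symmetric_mat n P" "P \<in> carrier_mat n n" using P by (auto simp: pos_def_def symmetric_mat_def)
  define M0 where "M0 = A0 + B0 * K"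
  have M0: "M0 \<in> carrier_mat n n" using A0 B0 K by (auto simp: M0_def)
  \<comment> \<open>Along the perturbation the form at \<open>v\<close> is the affine function
    \<open>c0 + t * d\<close>. Its slope \<open>d\<close> is positive because \<open>w\<close> is
    nonzero and \<open>P\<close> is positive definite, so the \<open>t\<close> chosen below is its
    root.\<close>
  define c0 where "c0 = v \<bullet> ((M0\<^sup>T * P + P * M0) *\<^sub>v v) + v \<bullet> (R *\<^sub>v v)"
  define d where "d = 2 * (w \<bullet> w) * (v \<bullet> (P *\<^sub>v v))"
  have d: "d > 0"
    using P v w scalar_prod_self_pos[OF w] by (simp add: d_def pos_def_def)
  define t where "t = - c0 / d"
  \<comment> \<open>The rank-one matrix \<open>t v w\<^sup>T\<close> maps \<open>w = D v\<close> to a multiple of \<open>v\<close>, so that moving along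
    \<open>(M D1, M D2)\<close> changes the quadratic form at \<open>v\<close> by an arbitrary amount.\<close>
  define M where "M = mat n n (\<lambda>(r, c). t * v $ r * w $ c)"
  have M: "M \<in> carrier_mat n n" by (simp add: M_def)
  have Mw: "M *\<^sub>v w = (t * (w \<bullet> w)) \<cdot>\<^sub>v v"
    using v w by (intro eq_vecI) (auto simp: M_def scalar_prod_def sum_distrib_left ac_simps)
  define A where "A = A0 + M * D1"
  define B where "B = B0 + M * D2"
  have MD: "M * D1 \<in> carrier_mat n n" "M * D2 \<in> carrier_mat n m" using M D1 D2 by auto
  have AB: "A \<in> carrier_mat n n" "B \<in> carrier_mat n m"
    using A0 B0 MD by (auto simp: A_def B_def)
  have "A * X + B * U = A0 * X + B0 * U + M * (D1 * X + D2 * U)"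
  proof -
    have c: "A0 * X \<in> carrier_mat n T" "B0 * U \<in> carrier_mat n T" "D1 * X \<in> carrier_mat n T"
        "D2 * U \<in> carrier_mat n T"
      using A0 B0 D1 D2 X U by auto
    have c': "M * (D1 * X) \<in> carrier_mat n T" "M * (D2 * U) \<in> carrier_mat n T"
      using M c by auto
    have "A * X + B * U = (A0 * X + M * (D1 * X)) + (B0 * U + M * (D2 * U))"
      unfolding A_def B_def add_mult_distrib_mat[OF A0 MD(1) X] add_mult_distrib_mat[OF B0 MD(2) U]
        assoc_mult_mat[OF M D1 X] assoc_mult_mat[OF M D2 U] ..
    also have "\<dots> = A0 * X + B0 * U + (M * (D1 * X) + M * (D2 * U))"
      using c c' by (intro eq_matI) (auto simp del: index_mult_mat(1))
    finally show ?thesis unfolding mult_add_distrib_mat[OF M c(3,4)] .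
  qed
  also have "\<dots> = A0 * X + B0 * U"
    unfolding kernel using M A0 B0 X U by auto
  finally have eq: "A * X + B * U = A0 * X + B0 * U" .
  define N where "N = A + B * K"
  have N: "N \<in> carrier_mat n n" using AB K by (auto simp: N_def)
  have "N = M0 + M * D"
  proof -
    have c: "B0 * K \<in> carrier_mat n n" "D2 * K \<in> carrier_mat n n"
      using B0 D2 K by auto
    have "N = (A0 + M * D1) + (B0 * K + M * (D2 * K))"
      unfolding N_def A_def B_def add_mult_distrib_mat[OF B0 MD(2) K] assoc_mult_mat[OF M D2 K] ..
    also have "\<dots> = M0 + (M * D1 + M * (D2 * K))"
      unfolding M0_def using A0 c M D1 by (intro eq_matI) (auto simp del: index_mult_mat(1))
    finally show ?thesis unfolding D_def mult_add_distrib_mat[OF M D1 c(2)] .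
  qed
  then have Nv: "N *\<^sub>v v = M0 *\<^sub>v v + (t * (w \<bullet> w)) \<cdot>\<^sub>v v"
    using M0 M D v Mw
    by (simp add: w_def add_mult_distrib_mat_vec[of _ n n] assoc_mult_mat_vec[of _ n n _ n])
  have NPc: "N\<^sup>T * P + P * N \<in> carrier_mat n n" using N Ps by auto
  have "v \<bullet> ((N\<^sup>T * P + P * N + R) *\<^sub>v v) = v \<bullet> ((N\<^sup>T * P + P * N) *\<^sub>v v) + v \<bullet> (R *\<^sub>v v)"
    unfolding add_mult_distrib_mat_vec[OF NPc R v(1)]
    using NPc R v by (intro scalar_prod_add_distrib[of _ n]) auto
  also have "v \<bullet> ((N\<^sup>T * P + P * N) *\<^sub>v v) = 2 * ((N *\<^sub>v v) \<bullet> (P *\<^sub>v v))"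
    by (rule lyapunov_quadratic_form[OF N Ps(1) v(1)])
  also have "(N *\<^sub>v v) \<bullet> (P *\<^sub>v v) = (M0 *\<^sub>v v) \<bullet> (P *\<^sub>v v) + t * (w \<bullet> w) * (v \<bullet> (P *\<^sub>v v))"
    unfolding Nv using M0 Ps v by (subst add_scalar_prod_distrib[of _ n]) auto
  also have "2 * \<dots> + v \<bullet> (R *\<^sub>v v) = c0 + t * d"
    using lyapunov_quadratic_form[OF M0 Ps(1) v(1)] by (simp add: c0_def d_def algebra_simps)
  also have "\<dots> = 0" using d by (simp add: t_def)
  finally show False
    using neg[OF AB eq v] by (simp add: N_def)
qed

section \<open>Uniform margin on a compatibility set\<close>

lemma minus_add_minus_mat:
  fixes A B C D :: "real mat"
  assumes "A \<in> carrier_mat nr nc" "B \<in> carrier_mat nr nc" "C \<in> carrier_mat nr nc" "D \<in> carrier_mat nr nc"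
  shows "(A - B) + (C - D) = (A + C) - (B + D)"
  using assms by (intro eq_matI) auto

lemma minus_mat_eq_zeroD:
  fixes A B :: "real mat"
  assumes "A - B = 0\<^sub>m nr nc" and A: "A \<in> carrier_mat nr nc" and B: "B \<in> carrier_mat nr nc"
  shows "A = B"
proof (rule eq_matI)
  fix i j assume ij: "i < dim_row B" "j < dim_col B"
  then have "(A - B) $$ (i, j) = 0" unfolding assms(1) using B by simp
  then show "A $$ (i, j) = B $$ (i, j)" using ij by simp
qed (use A B in auto)

text \<open>Although the pairs \<open>(A, B)\<close> may be unbounded, the form depends on them only
  through the closed loop, which is a continuous function of the noise alone. The maximum over the
  compact noise parameters supplies \<open>\<epsilon>\<close>. The matrix \<open>R\<close> collects
  the terms independent of the pair.\<close>

lemma uniformly_negative_on_compat_set: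
  fixes X U Xdot P K R \<Phi> \<Phi>11 \<Phi>12 \<Phi>22 :: "real mat"
  assumes X: "X \<in> carrier_mat n T" and U: "U \<in> carrier_mat m T" and Xdot: "Xdot \<in> carrier_mat n T"
    and blocks: "\<Phi>11 \<in> carrier_mat n n" "\<Phi>12 \<in> carrier_mat n T" "\<Phi>22 \<in> carrier_mat T T"
    and \<Phi>_eq: "\<Phi> = four_block_mat \<Phi>11 \<Phi>12 \<Phi>12\<^sup>T \<Phi>22"
    and \<Phi>: "symmetric_mat (n + T) \<Phi>" and \<Phi>22: "neg_def T \<Phi>22"
    and K: "K \<in> carrier_mat m n" and R: "R \<in> carrier_mat n n" and P: "pos_def n P"
    and neg: "\<And>A B v. (A, B) \<in> compat_set n m Xdot X U (noise_set n T \<Phi>) \<Longrightarrow>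
      v \<in> carrier_vec n \<Longrightarrow> v \<noteq> 0\<^sub>v n \<Longrightarrow>
      v \<bullet> (((A + B * K)\<^sup>T * P + P * (A + B * K) + R) *\<^sub>v v) < 0"
  obtains \<epsilon> where "\<epsilon> > 0"
    "\<And>A B v. (A, B) \<in> compat_set n m Xdot X U (noise_set n T \<Phi>) \<Longrightarrow> v \<in> carrier_vec n \<Longrightarrow>
      v \<bullet> (((A + B * K)\<^sup>T * P + P * (A + B * K) + R) *\<^sub>v v) \<le> - \<epsilon> * (v \<bullet> v)"
proof -
  let ?C = "compat_set n m Xdot X U (noise_set n T \<Phi>)"
  obtain H1 H2 where H: "H1 \<in> carrier_mat T n" "H2 \<in> carrier_mat T m"
    and XJ: "X * (H1 * X + H2 * U) = X" and UJ: "U * (H1 * X + H2 * U) = U"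
    using stacked_generalized_inverse_exists[OF X U] .
  \<comment> \<open>Right multiplication by \<open>J\<close> fixes \<open>X\<close> and
    \<open>U\<close>. Hence \<open>V * J = V\<close> characterizes the matrices \<open>V\<close> of
    the form \<open>A * X + B * U\<close>.\<close>
  define J where "J = H1 * X + H2 * U"
  define G where "G = H1 + H2 * K"
  have J: "J \<in> carrier_mat T T" and G: "G \<in> carrier_mat T n"
    using H X U K by (auto simp: J_def G_def)
  have Pc: "P \<in> carrier_mat n n" using P by (simp add: pos_def_def symmetric_mat_def)
  obtain r where r: "\<And>W i j. W \<in> noise_set n T \<Phi> \<Longrightarrow> i < n \<Longrightarrow> j < T \<Longrightarrow> W $$ (i, j) \<in> {-r..r}" "0 \<le> r"
    using noise_set_bounded[OF blocks \<Phi>_eq \<Phi> \<Phi>22] by blast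
  define Y where "Y w = Xdot - mat n T w" for w
  \<comment> \<open>The last condition selects the noise for which some pair explains the data.
    Entries of \<open>w\<close> outside the index range are only confined to the box.\<close>
  define S where "S = {w. \<forall>p. w p \<in> {-r..r}} \<inter> ({w. mat n T w \<in> noise_set n T \<Phi>} \<inter> {w. Y w * J = Y w})"
  define F where "F w = (Y w * G)\<^sup>T * P + P * (Y w * G) + R" for w
  have Y: "Y w \<in> carrier_mat n T" for w
    unfolding Y_def by (rule minus_carrier_mat) simp
  have Y_cont: "entrywise_continuous n T Y"
    unfolding Y_def by (intro entrywise_continuous_minus entrywise_continuous_const entrywise_continuous_mat Xdot)
  have YJ_cont: "entrywise_continuous n T (\<lambda>w. Y w * J)"
    by (rule entrywise_continuous_mult[OF Y_cont entrywise_continuous_const[OF J]])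
  have S: "compact S"
    unfolding S_def using closed_noise_set[OF \<Phi>] closed_mat_eq[OF YJ_cont Y_cont]
    by (intro compact_Int_closed compact_box closed_Int)
  have F: "entrywise_continuous n n F"
  proof -
    have YG: "entrywise_continuous n n (\<lambda>w. Y w * G)"
      by (rule entrywise_continuous_mult[OF Y_cont entrywise_continuous_const[OF G]])
    have P': "entrywise_continuous n n (\<lambda>w :: nat \<times> nat \<Rightarrow> real. P)"
      by (rule entrywise_continuous_const[OF Pc])
    show ?thesis
      unfolding F_def
      by (rule entrywise_continuous_add[OF entrywise_continuous_add[OF
          entrywise_continuous_mult[OF entrywise_continuous_transpose[OF YG] P']
          entrywise_continuous_mult[OF P' YG]] entrywise_continuous_const[OF R]])
  qed
  have neg_F: "v \<bullet> (F w *\<^sub>v v) < 0" if w: "w \<in> S" and v: "v \<in> carrier_vec n" "v \<noteq> 0\<^sub>v n" for w v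
  proof -
    \<comment> \<open>A particular pair explaining the data with noise \<open>w\<close>. Its closed
      loop is \<open>Y w * G\<close>, so the hypothesis \<open>neg\<close> applies to
      \<open>F w\<close>.\<close>
    define A where "A = Y w * H1"
    define B where "B = Y w * H2"
    have "A * X + B * U = Y w * J"
      unfolding A_def B_def J_def assoc_mult_mat[OF Y H(1) X] assoc_mult_mat[OF Y H(2) U]
      using H X U by (intro mult_add_distrib_mat[OF Y, symmetric]) auto
    also have "\<dots> = Y w" using w by (simp add: S_def)
    finally have "A * X + B * U + mat n T w = Y w + mat n T w" by simp
    also have "\<dots> = Xdot"
      unfolding Y_def using Xdot by (intro eq_matI) auto
    finally have "(A, B) \<in> ?C"
      using w mult_carrier_mat[OF Y H(1)] mult_carrier_mat[OF Y H(2)]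
      by (auto simp: compat_set_def A_def B_def S_def intro!: bexI[of _ "mat n T w"])
    moreover have "A + B * K = Y w * G"
      unfolding A_def B_def G_def assoc_mult_mat[OF Y H(2) K]
      using H K by (intro mult_add_distrib_mat[OF Y, symmetric]) auto
    ultimately show ?thesis
      using neg[of A B, OF _ v] by (simp add: F_def)
  qed
  obtain C where C: "\<And>w v. w \<in> S \<Longrightarrow> v \<in> carrier_vec n \<Longrightarrow> v \<bullet> (F w *\<^sub>v v) \<le> C * (v \<bullet> v)" "C < 0"
    using quadratic_form_bounded_on_compact[OF S F] neg_F by metis
  show ?thesis
  proof (rule that[of "- C"])
    fix A B and v :: "real vec" assume AB: "(A, B) \<in> ?C" and v: "v \<in> carrier_vec n"
    then obtain W where W: "W \<in> noise_set n T \<Phi>" "Xdot = A * X + B * U + W"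
      and A: "A \<in> carrier_mat n n" and B: "B \<in> carrier_mat n m"
      by (auto simp: compat_set_def)
    have Wc: "W \<in> carrier_mat n T" using W by (simp add: noise_set_def)
    \<comment> \<open>The entries of \<open>W\<close> padded by zero, which lies in the box since
      \<open>0 \<le> r\<close>.\<close>
    define w where "w p = (if fst p < n \<and> snd p < T then W $$ p else 0)" for p
    have mat_w: "mat n T w = W" using Wc by (intro eq_matI) (auto simp: w_def)
    have Z: "A * X + B * U \<in> carrier_mat n T" using A B X U by auto
    have "V + W - W = V" if "V \<in> carrier_mat n T" for V
      using that Wc by (intro eq_matI) auto
    then have Yw: "Y w = A * X + B * U"
      unfolding Y_def mat_w W(2) using Z by blast
    have YJ: "Y w * J = Y w"
    proof -
      have "Y w * J = A * X * J + B * U * J"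
        unfolding Yw using A B X U J by (intro add_mult_distrib_mat) auto
      also have "\<dots> = A * X + B * U"
        unfolding assoc_mult_mat[OF A X J] assoc_mult_mat[OF B U J] using XJ UJ by (simp add: J_def)
      finally show ?thesis by (simp add: Yw)
    qed
    have "w p \<in> {-r..r}" for p
      using r(1)[OF W(1), of "fst p" "snd p"] r(2) by (auto simp: w_def)
    then have wS: "w \<in> S"
      using W(1) YJ mat_w by (simp add: S_def)
    \<comment> \<open>The difference between the given pair and the particular pair for the same
      noise lies in the kernel of the data, so both have the same closed loop.\<close>
    define D1 where "D1 = A - Y w * H1"
    define D2 where "D2 = B - Y w * H2"
    have YH: "Y w * H1 \<in> carrier_mat n n" "Y w * H2 \<in> carrier_mat n m" using Y[of w] H by auto
    have D: "D1 \<in> carrier_mat n n" "D2 \<in> carrier_mat n m" using YH by (simp_all add: D1_def D2_def minus_carrier_mat)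
    have "D1 * X + D2 * U = 0\<^sub>m n T"
    proof -
      have HX: "H1 * X \<in> carrier_mat T T" "H2 * U \<in> carrier_mat T T" using H X U by auto
      have c: "A * X \<in> carrier_mat n T" "B * U \<in> carrier_mat n T" 
        "Y w * (H1 * X) \<in> carrier_mat n T" "Y w * (H2 * U) \<in> carrier_mat n T"
        using A B X U Y[of w] HX by auto
      have "D1 * X + D2 * U = (A * X - Y w * (H1 * X)) + (B * U - Y w * (H2 * U))"
        unfolding D1_def D2_def minus_mult_distrib_mat[OF A YH(1) X]
          minus_mult_distrib_mat[OF B YH(2) U] assoc_mult_mat[OF Y H(1) X] assoc_mult_mat[OF Y H(2) U] ..
      also have "\<dots> = (A * X + B * U) - (Y w * (H1 * X) + Y w * (H2 * U))"
        by (rule minus_add_minus_mat[OF c(1,3,2,4)])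
      also have "Y w * (H1 * X) + Y w * (H2 * U) = Y w"
        using YJ unfolding J_def mult_add_distrib_mat[OF Y HX] .
      finally show ?thesis using Z by (simp add: Yw)
    qed
    then have "D1 + D2 * K = 0\<^sub>m n n"
    proof (rule closed_loop_vanishes_on_kernel[OF A B D X U K R P])
      fix A' B' and u :: "real vec"
      assume "A' \<in> carrier_mat n n" "B' \<in> carrier_mat n m" "A' * X + B' * U = A * X + B * U"
        and u: "u \<in> carrier_vec n" "u \<noteq> 0\<^sub>v n"
      \<comment> \<open>The noise \<open>W\<close> of the original pair also serves every pair with
        the same product.\<close>
      then have "(A', B') \<in> ?C" using W by (auto simp: compat_set_def)
      then show "u \<bullet> (((A' + B' * K)\<^sup>T * P + P * (A' + B' * K) + R) *\<^sub>v u) < 0"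
        using neg u by blast
    qed
    moreover have "D1 + D2 * K = (A + B * K) - Y w * G"
    proof -
      have HK: "H2 * K \<in> carrier_mat T n" using H K by auto
      have c: "B * K \<in> carrier_mat n n" "Y w * (H2 * K) \<in> carrier_mat n n"
        using B K Y[of w] HK by auto
      have "D1 + D2 * K = (A - Y w * H1) + (B * K - Y w * (H2 * K))"
        unfolding D1_def D2_def minus_mult_distrib_mat[OF B YH(2) K] assoc_mult_mat[OF Y H(2) K] ..
      then show ?thesis
        unfolding G_def mult_add_distrib_mat[OF Y H(1) HK] minus_add_minus_mat[OF A YH(1) c] .
    qed
    ultimately have diff: "(A + B * K) - Y w * G = 0\<^sub>m n n" by simp
    have "A + B * K = Y w * G"
      using A B K Y[of w] G by (intro minus_mat_eq_zeroD[OF diff]) auto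
    then show "v \<bullet> (((A + B * K)\<^sup>T * P + P * (A + B * K) + R) *\<^sub>v v) \<le> - (- C) * (v \<bullet> v)"
      using C(1)[OF wS v] by (simp add: F_def)
  qed (use C in simp)
qed

section \<open>The Lyapunov expression and its perturbation\<close>

lemma coupling_carrier: "coupling n N \<pi> P i \<in> carrier_mat n n"
  by (simp add: coupling_def)

lemma coupling_quadratic_form:
  assumes P: "\<And>j. j < N \<Longrightarrow> P j \<in> carrier_mat n n" and v: "v \<in> carrier_vec n"
  shows "v \<bullet> (coupling n N \<pi> P i *\<^sub>v v) = (\<Sum>j<N. \<pi> $$ (j, i) * (v \<bullet> (P j *\<^sub>v v)))"
proof -
  have "v \<bullet> (coupling n N \<pi> P i *\<^sub>v v) =
      (\<Sum>r<n. \<Sum>c<n. \<Sum>j<N. \<pi> $$ (j, i) * (v $ r * P j $$ (r, c) * v $ c))"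
    unfolding scalar_prod_mult_mat_vec[OF coupling_carrier v v]
    by (intro sum.cong refl)
      (simp add: coupling_def sum_distrib_left sum_distrib_right ac_simps)
  also have "\<dots> = (\<Sum>r<n. \<Sum>j<N. \<Sum>c<n. \<pi> $$ (j, i) * (v $ r * P j $$ (r, c) * v $ c))"
    by (intro sum.cong refl sum.swap)
  also have "\<dots> = (\<Sum>j<N. \<Sum>r<n. \<Sum>c<n. \<pi> $$ (j, i) * (v $ r * P j $$ (r, c) * v $ c))"
    by (rule sum.swap)
  also have "\<dots> = (\<Sum>j<N. \<pi> $$ (j, i) * (v \<bullet> (P j *\<^sub>v v)))"
    by (intro sum.cong refl) (simp add: scalar_prod_mult_mat_vec[OF P v v] sum_distrib_left)
  finally show ?thesis .
qed

lemma symmetric_mat_add: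
  "symmetric_mat n A \<Longrightarrow> symmetric_mat n B \<Longrightarrow> symmetric_mat n (A + B)"
  by (auto simp: symmetric_mat_def transpose_add)

lemma symmetric_mat_coupling:
  assumes "\<And>j. j < N \<Longrightarrow> symmetric_mat n (P j)"
  shows "symmetric_mat n (coupling n N \<pi> P i)"
proof -
  have "P j $$ (c, r) = P j $$ (r, c)" if "j < N" "r < n" "c < n" for j r c
    using assms[OF that(1)] that unfolding symmetric_mat_def
    by (metis carrier_matD index_transpose_mat(1))
  then show ?thesis
    by (auto simp: symmetric_mat_def coupling_def intro!: eq_matI sum.cong)
qed

text \<open>Definiteness includes symmetry, so symmetry has to be established again for each new
  choice of \<open>Q\<close> and \<open>\<pi>\<close>.\<close>

lemma symmetric_mat_lyapunov_lhs:
  assumes A: "A \<in> carrier_mat n n" and B: "B \<in> carrier_mat n m" and K: "K i \<in> carrier_mat m n"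
    and P: "\<And>j. j < N \<Longrightarrow> symmetric_mat n (P j)" and Q: "symmetric_mat n Q" and i: "i < N"
  shows "symmetric_mat n (lyapunov_lhs n N K P Q \<pi> i A B)"
proof -
  define M where "M = A + B * K i"
  have M: "M \<in> carrier_mat n n" "M\<^sup>T \<in> carrier_mat n n" using A B K by (auto simp: M_def)
  have Pi: "P i \<in> carrier_mat n n" "(P i)\<^sup>T = P i" using P[OF i] by (auto simp: symmetric_mat_def)
  have c: "M\<^sup>T * P i \<in> carrier_mat n n" "P i * M \<in> carrier_mat n n" using M Pi by auto
  have "(M\<^sup>T * P i + P i * M)\<^sup>T = P i * M + M\<^sup>T * P i"
    unfolding transpose_add[OF c] transpose_mult[OF M(2) Pi(1)] transpose_mult[OF Pi(1) M(1)]
    using Pi(2) by simp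
  also have "\<dots> = M\<^sup>T * P i + P i * M" using c by (intro comm_add_mat) auto
  finally have L: "symmetric_mat n (M\<^sup>T * P i + P i * M)" using c by (simp add: symmetric_mat_def)
  have "symmetric_mat n (coupling n N \<pi> P i)" by (rule symmetric_mat_coupling[OF P])
  then show ?thesis
    unfolding lyapunov_lhs_def M_def[symmetric] by (intro symmetric_mat_add[OF symmetric_mat_add[OF L] Q])
qed

text \<open>The form splits into a term independent of \<open>\<pi>\<close> and \<open>Q\<close>, a
  term linear in \<open>\<pi>\<close> and a term linear in \<open>Q\<close>. Different choices of
  these can then be compared as real numbers.\<close>

lemma lyapunov_lhs_quadratic_form:
  assumes A: "A \<in> carrier_mat n n" and B: "B \<in> carrier_mat n m" and K: "K i \<in> carrier_mat m n"
    and P: "\<And>j. j < N \<Longrightarrow> P j \<in> carrier_mat n n" and Q: "Q \<in> carrier_mat n n" and i: "i < N"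
    and v: "v \<in> carrier_vec n"
  shows "v \<bullet> (lyapunov_lhs n N K P Q \<pi> i A B *\<^sub>v v) =
    v \<bullet> (((A + B * K i)\<^sup>T * P i + P i * (A + B * K i)) *\<^sub>v v) +
    (\<Sum>j<N. \<pi> $$ (j, i) * (v \<bullet> (P j *\<^sub>v v))) + v \<bullet> (Q *\<^sub>v v)"
proof -
  define L where "L = (A + B * K i)\<^sup>T * P i + P i * (A + B * K i)"
  define S where "S = coupling n N \<pi> P i"
  have M: "A + B * K i \<in> carrier_mat n n" using A B K by auto
  have L: "L \<in> carrier_mat n n" using M P[OF i] by (auto simp: L_def)
  have S: "S \<in> carrier_mat n n" by (simp add: S_def coupling_carrier)
  have LS: "L + S \<in> carrier_mat n n" using S by auto
  have c: "L *\<^sub>v v \<in> carrier_vec n" "S *\<^sub>v v \<in> carrier_vec n" "Q *\<^sub>v v \<in> carrier_vec n"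
    using L S Q v by auto
  have "v \<bullet> ((L + S + Q) *\<^sub>v v) = v \<bullet> (L *\<^sub>v v) + v \<bullet> (S *\<^sub>v v) + v \<bullet> (Q *\<^sub>v v)"
    unfolding add_mult_distrib_mat_vec[OF LS Q v] add_mult_distrib_mat_vec[OF L S v]
    using c v by (simp add: scalar_prod_add_distrib[of _ n])
  also have "v \<bullet> (S *\<^sub>v v) = (\<Sum>j<N. \<pi> $$ (j, i) * (v \<bullet> (P j *\<^sub>v v)))"
    unfolding S_def using P v by (rule coupling_quadratic_form)
  finally show ?thesis
    unfolding lyapunov_lhs_def L_def[symmetric] S_def[symmetric] .
qed

lemma pos_def_imp_pos_semidef: "pos_def n M \<Longrightarrow> pos_semidef n M"
  unfolding pos_def_def pos_semidef_def
  by (metis less_le order_refl mult_mat_vec_carrier scalar_prod_left_zero symmetric_mat_def)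

lemma add_scalar_identity_pos_def:
  assumes Q: "pos_semidef n Q" and \<delta>: "\<delta> > 0"
  shows "pos_def n (Q + \<delta> \<cdot>\<^sub>m 1\<^sub>m n)"
    and "\<And>v. v \<in> carrier_vec n \<Longrightarrow> v \<bullet> ((Q + \<delta> \<cdot>\<^sub>m 1\<^sub>m n) *\<^sub>v v) = v \<bullet> (Q *\<^sub>v v) + \<delta> * (v \<bullet> v)"
proof -
  have Qc: "Q \<in> carrier_mat n n" using Q by (simp add: pos_semidef_def symmetric_mat_def)
  have I: "\<delta> \<cdot>\<^sub>m 1\<^sub>m n \<in> carrier_mat n n" by simp
  show form: "v \<bullet> ((Q + \<delta> \<cdot>\<^sub>m 1\<^sub>m n) *\<^sub>v v) = v \<bullet> (Q *\<^sub>v v) + \<delta> * (v \<bullet> v)"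
    if v: "v \<in> carrier_vec n" for v
  proof -
    have "(\<delta> \<cdot>\<^sub>m 1\<^sub>m n) *\<^sub>v v = \<delta> \<cdot>\<^sub>v v"
      using v by (intro eq_vecI) auto
    then show ?thesis
      unfolding add_mult_distrib_mat_vec[OF Qc I v]
      using v Qc by (simp add: scalar_prod_add_distrib[of _ n])
  qed
  have "symmetric_mat n (\<delta> \<cdot>\<^sub>m 1\<^sub>m n)"
    by (auto simp: symmetric_mat_def intro!: eq_matI)
  then have "symmetric_mat n (Q + \<delta> \<cdot>\<^sub>m 1\<^sub>m n)"
    using Q by (intro symmetric_mat_add) (auto simp: pos_semidef_def)
  moreover have "0 < v \<bullet> ((Q + \<delta> \<cdot>\<^sub>m 1\<^sub>m n) *\<^sub>v v)" if "v \<in> carrier_vec n" "v \<noteq> 0\<^sub>v n" for v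
    using Q that scalar_prod_self_pos[OF that] \<delta>
    by (simp add: form pos_semidef_def add_nonneg_pos)
  ultimately show "pos_def n (Q + \<delta> \<cdot>\<^sub>m 1\<^sub>m n)" by (simp add: pos_def_def)
qed

text \<open>The added matrix is \<open>\<eta>\<close> times the all-ones matrix minus
  \<open>N\<close> times the identity: its off-diagonal entries are \<open>\<eta>\<close>, and each
  column sums to \<open>\<eta> * (N - N) = 0\<close>.\<close>

lemma perturbed_rate_mat:
  assumes \<pi>: "\<pi> \<in> rate_mats N" and \<eta>: "\<eta> > 0"
  shows "mat N N (\<lambda>(i, j). \<pi> $$ (i, j) + \<eta> * (1 - (if i = j then real N else 0))) \<in> pos_rate_mats N"
    (is "?\<rho> \<in> _")
proof -
  have "(\<Sum>i<N. ?\<rho> $$ (i, j)) = 0" if "j < N" for j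
  proof -
    have "(\<Sum>i<N. ?\<rho> $$ (i, j)) =
        (\<Sum>i<N. \<pi> $$ (i, j)) + \<eta> * (real N - (\<Sum>i<N. if i = j then real N else 0))"
      using that by (simp add: sum.distrib sum_subtractf flip: sum_distrib_left)
    then show ?thesis using \<pi> that by (simp add: rate_mats_def)
  qed
  moreover have "?\<rho> $$ (i, j) > 0" if "i < N" "j < N" "i \<noteq> j" for i j
    using \<pi> \<eta> that by (simp add: rate_mats_def add_nonneg_pos)
  ultimately show ?thesis by (simp add: pos_rate_mats_def)
qed

section \<open>Passing between strict and non-strict inequalities\<close>

theorem lemma2:
  fixes N n m :: nat
    and T :: "nat \<Rightarrow> nat"
    and Abar Bbar X Xdot U Wbar \<Phi> \<Phi>11 \<Phi>12 \<Phi>22 :: "nat \<Rightarrow> real mat"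
    and \<W> :: "nat \<Rightarrow> real mat set"
    and \<C> :: "nat \<Rightarrow> (real mat \<times> real mat) set"
  assumes "\<And>i. i < N \<Longrightarrow> Abar i \<in> carrier_mat n n"
    and "\<And>i. i < N \<Longrightarrow> Bbar i \<in> carrier_mat n m"
    and "\<And>i. i < N \<Longrightarrow> X i \<in> carrier_mat n (T i)"
    and "\<And>i. i < N \<Longrightarrow> Xdot i \<in> carrier_mat n (T i)"
    and "\<And>i. i < N \<Longrightarrow> U i \<in> carrier_mat m (T i)"
    and "\<And>i. i < N \<Longrightarrow> \<Phi>11 i \<in> carrier_mat n n"
    and "\<And>i. i < N \<Longrightarrow> \<Phi>12 i \<in> carrier_mat n (T i)"
    and "\<And>i. i < N \<Longrightarrow> \<Phi>22 i \<in> carrier_mat (T i) (T i)"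
    and "\<And>i. i < N \<Longrightarrow> \<Phi> i = four_block_mat (\<Phi>11 i) (\<Phi>12 i) (transpose_mat (\<Phi>12 i)) (\<Phi>22 i)"
    and "\<And>i. i < N \<Longrightarrow> symmetric_mat (n + T i) (\<Phi> i)"
    and "\<And>i. i < N \<Longrightarrow> neg_def (T i) (\<Phi>22 i)"
    and "\<And>i. i < N \<Longrightarrow> \<W> i = noise_set n (T i) (\<Phi> i)"
    and "\<And>i. i < N \<Longrightarrow> Wbar i \<in> \<W> i"
    and "\<And>i. i < N \<Longrightarrow> Xdot i = Abar i * X i + Bbar i * U i + Wbar i"
    and "\<And>i. i < N \<Longrightarrow> \<C> i = compat_set n m (Xdot i) (X i) (U i) (\<W> i)"
  shows
    "(\<exists>(K :: nat \<Rightarrow> real mat) (P :: nat \<Rightarrow> real mat) Q \<pi>.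
        (\<forall>i<N. K i \<in> carrier_mat m n) \<and> (\<forall>i<N. pos_def n (P i)) \<and>
        pos_semidef n Q \<and> \<pi> \<in> rate_mats N \<and>
        (\<forall>i<N. \<forall>(A, B) \<in> \<C> i. neg_def n (lyapunov_lhs n N K P Q \<pi> i A B)))
     \<longleftrightarrow>
     (\<exists>(K :: nat \<Rightarrow> real mat) (P :: nat \<Rightarrow> real mat) Q \<pi>.
        (\<forall>i<N. K i \<in> carrier_mat m n) \<and> (\<forall>i<N. pos_def n (P i)) \<and>
        pos_def n Q \<and> \<pi> \<in> pos_rate_mats N \<and>
        (\<forall>i<N. \<forall>(A, B) \<in> \<C> i. neg_semidef n (lyapunov_lhs n N K P Q \<pi> i A B)))"
  (is "?weak \<longleftrightarrow> ?strict")
proof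
  assume ?strict
  then obtain K P Q \<pi> where K: "\<forall>i<N. K i \<in> carrier_mat m n" and P: "\<forall>i<N. pos_def n (P i)"
    and Q: "pos_def n Q" and \<pi>: "\<pi> \<in> pos_rate_mats N"
    and le: "\<And>i A B. i < N \<Longrightarrow> (A, B) \<in> \<C> i \<Longrightarrow> neg_semidef n (lyapunov_lhs n N K P Q \<pi> i A B)"
    by blast
  have Qc: "Q \<in> carrier_mat n n" using Q by (simp add: pos_def_def symmetric_mat_def)
  have Ps: "symmetric_mat n (P j)" "P j \<in> carrier_mat n n" if "j < N" for j
    using P that by (auto simp: pos_def_def symmetric_mat_def)
  have zero: "symmetric_mat n (0\<^sub>m n n)" by (simp add: symmetric_mat_def)
  have zero_form: "v \<bullet> (0\<^sub>m n n *\<^sub>v v) = 0" if "v \<in> carrier_vec n" for v :: "real vec"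
    by (simp add: scalar_prod_mult_mat_vec[OF zero_carrier_mat that that])
  \<comment> \<open>Removing \<open>Q\<close> lowers the form by
    \<open>v \<bullet> (Q *\<^sub>v v)\<close>, which is positive for nonzero \<open>v\<close>; this
    makes the inequality strict.\<close>
  have "neg_def n (lyapunov_lhs n N K P (0\<^sub>m n n) \<pi> i A B)" if i: "i < N" and AB: "(A, B) \<in> \<C> i" for i A B
  proof -
    have c: "A \<in> carrier_mat n n" "B \<in> carrier_mat n m"
      using AB assms(15)[OF i] by (auto simp: compat_set_def)
    note Ki = K[rule_format, OF i]
    have "v \<bullet> (lyapunov_lhs n N K P (0\<^sub>m n n) \<pi> i A B *\<^sub>v v) < 0" if v: "v \<in> carrier_vec n" "v \<noteq> 0\<^sub>v n" for v
    proof -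
      have "v \<bullet> (lyapunov_lhs n N K P Q \<pi> i A B *\<^sub>v v) \<le> 0"
        using le[OF i AB] v by (simp add: neg_semidef_def)
      moreover have "v \<bullet> (Q *\<^sub>v v) > 0" using Q v by (simp add: pos_def_def)
      ultimately show ?thesis
        using v Ps(2) by (simp add: zero_form lyapunov_lhs_quadratic_form[where K = K and i = i, OF c Ki _ Qc i v(1)]
            lyapunov_lhs_quadratic_form[where K = K and i = i, OF c Ki _ zero_carrier_mat i v(1)])
    qed
    then show ?thesis
      using symmetric_mat_lyapunov_lhs[where K = K and i = i, OF c Ki Ps(1) zero i] by (simp add: neg_def_def)
  qed
  moreover have "pos_semidef n (0\<^sub>m n n)" using zero by (simp add: pos_semidef_def zero_form)
  moreover have "\<pi> \<in> rate_mats N"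
    using \<pi> by (auto simp: rate_mats_def pos_rate_mats_def intro: less_imp_le)
  ultimately show ?weak using K P by blast
next
  assume ?weak
  then obtain K P Q \<pi> where K: "\<forall>i<N. K i \<in> carrier_mat m n" and P: "\<forall>i<N. pos_def n (P i)"
    and Q: "pos_semidef n Q" and \<pi>: "\<pi> \<in> rate_mats N"
    and less: "\<And>i A B. i < N \<Longrightarrow> (A, B) \<in> \<C> i \<Longrightarrow> neg_def n (lyapunov_lhs n N K P Q \<pi> i A B)"
    by blast
  have Qc: "Q \<in> carrier_mat n n" using Q by (simp add: pos_semidef_def symmetric_mat_def)
  have Ps: "symmetric_mat n (P j)" "P j \<in> carrier_mat n n" if "j < N" for j
    using P that by (auto simp: pos_def_def symmetric_mat_def)
  have Pv: "0 \<le> v \<bullet> (P j *\<^sub>v v)" if "j < N" "v \<in> carrier_vec n" for j v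
    using P pos_def_imp_pos_semidef that by (auto simp: pos_semidef_def)
  have carrier: "A \<in> carrier_mat n n" "B \<in> carrier_mat n m" if "i < N" "(A, B) \<in> \<C> i" for i A B
    using that assms(15)[OF that(1)] by (auto simp: compat_set_def)
  have "\<exists>\<epsilon>>0. \<forall>A B v. (A, B) \<in> \<C> i \<longrightarrow> v \<in> carrier_vec n \<longrightarrow>
      v \<bullet> (lyapunov_lhs n N K P Q \<pi> i A B *\<^sub>v v) \<le> - \<epsilon> * (v \<bullet> v)" if i: "i < N" for i
  proof -
    define R where "R = coupling n N \<pi> P i + Q"
    have R: "R \<in> carrier_mat n n" using Qc by (simp add: R_def)
    have lhs: "lyapunov_lhs n N K P Q \<pi> i A B = (A + B * K i)\<^sup>T * P i + P i * (A + B * K i) + R"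
      if "(A, B) \<in> \<C> i" for A B
    proof -
      have M: "A + B * K i \<in> carrier_mat n n" using carrier[OF i that] K i by auto
      have "(A + B * K i)\<^sup>T * P i + P i * (A + B * K i) \<in> carrier_mat n n"
        using M Ps(2)[OF i] by auto
      then show ?thesis
        unfolding lyapunov_lhs_def R_def by (rule assoc_add_mat[OF _ coupling_carrier Qc])
    qed
    have C: "\<C> i = compat_set n m (Xdot i) (X i) (U i) (noise_set n (T i) (\<Phi> i))"
      using assms(12,15) i by simp
    have neg: "v \<bullet> (((A + B * K i)\<^sup>T * P i + P i * (A + B * K i) + R) *\<^sub>v v) < 0"
      if AB: "(A, B) \<in> \<C> i" and v: "v \<in> carrier_vec n" "v \<noteq> 0\<^sub>v n" for A B v
      using less[OF i AB] v unfolding lhs[OF AB] by (simp add: neg_def_def)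
    obtain \<epsilon> where "\<epsilon> > 0" "\<And>A B v. (A, B) \<in> \<C> i \<Longrightarrow> v \<in> carrier_vec n \<Longrightarrow>
        v \<bullet> (((A + B * K i)\<^sup>T * P i + P i * (A + B * K i) + R) *\<^sub>v v) \<le> - \<epsilon> * (v \<bullet> v)"
      using uniformly_negative_on_compat_set[OF assms(3,5,4,6-11)[OF i] K[rule_format, OF i] R
          P[rule_format, OF i] neg[unfolded C]]
      unfolding C by blast
    then show ?thesis using lhs by metis
  qed
  then obtain e where e: "\<And>i. i < N \<Longrightarrow> e i > 0"
    "\<And>i A B v. i < N \<Longrightarrow> (A, B) \<in> \<C> i \<Longrightarrow> v \<in> carrier_vec n \<Longrightarrow>
      v \<bullet> (lyapunov_lhs n N K P Q \<pi> i A B *\<^sub>v v) \<le> - e i * (v \<bullet> v)"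
    by metis
  \<comment> \<open>A common margin for all modes; inserting \<open>1\<close> keeps the set nonempty
    when \<open>N = 0\<close>.\<close>
  define \<epsilon> where "\<epsilon> = Min (insert 1 (e ` {..<N}))"
  have \<epsilon>: "\<epsilon> > 0" "\<And>i. i < N \<Longrightarrow> \<epsilon> \<le> e i"
    using e(1) by (auto simp: \<epsilon>_def)
  have "\<exists>C. \<forall>v\<in>carrier_vec n. v \<bullet> (P j *\<^sub>v v) \<le> C * (v \<bullet> v)" if "j < N" for j
    using quadratic_form_bounded[OF Ps(2)[OF that]] by metis
  then obtain c where c: "\<And>j v. j < N \<Longrightarrow> v \<in> carrier_vec n \<Longrightarrow> v \<bullet> (P j *\<^sub>v v) \<le> c j * (v \<bullet> v)"
    by metis
  define C where "C = (\<Sum>j<N. \<bar>c j\<bar>)"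
  have C: "0 \<le> C" by (simp add: C_def)
  have vv: "0 \<le> v \<bullet> v" if "v \<in> carrier_vec n" for v :: "real vec"
    by (simp add: scalar_prod_def sum_nonneg)
  have sum_P: "(\<Sum>j<N. v \<bullet> (P j *\<^sub>v v)) \<le> C * (v \<bullet> v)" if v: "v \<in> carrier_vec n" for v
    unfolding C_def sum_distrib_right
  proof (rule sum_mono)
    fix j assume "j \<in> {..<N}"
    then have "v \<bullet> (P j *\<^sub>v v) \<le> c j * (v \<bullet> v)" using c v by simp
    also have "\<dots> \<le> \<bar>c j\<bar> * (v \<bullet> v)" using vv[OF v] by (intro mult_right_mono) auto
    finally show "v \<bullet> (P j *\<^sub>v v) \<le> \<bar>c j\<bar> * (v \<bullet> v)" .
  qed
  \<comment> \<open>Half of the margin pays for the enlarged \<open>Q'\<close>, the other half for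
    the all-ones part of \<open>\<rho>\<close>. Adding \<open>1\<close> to \<open>C\<close> keeps
    the denominator positive.\<close>
  define \<eta> where "\<eta> = \<epsilon> / (2 * (C + 1))"
  have \<eta>: "\<eta> > 0" "\<eta> * C \<le> \<epsilon> / 2"
    using \<epsilon>(1) C by (auto simp: \<eta>_def field_simps)
  define \<rho> where "\<rho> = mat N N (\<lambda>(i, j). \<pi> $$ (i, j) + \<eta> * (1 - (if i = j then real N else 0)))"
  define Q' where "Q' = Q + (\<epsilon> / 2) \<cdot>\<^sub>m 1\<^sub>m n"
  have half: "\<epsilon> / 2 > 0" using \<epsilon>(1) by simp
  have Q': "pos_def n Q'" unfolding Q'_def by (rule add_scalar_identity_pos_def(1)[OF Q half])
  then have Q's: "symmetric_mat n Q'" "Q' \<in> carrier_mat n n"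
    by (auto simp: pos_def_def symmetric_mat_def)
  have "neg_semidef n (lyapunov_lhs n N K P Q' \<rho> i A B)" if i: "i < N" and AB: "(A, B) \<in> \<C> i" for i A B
  proof -
    note AB_carrier = carrier[OF i AB] and Ki = K[rule_format, OF i]
    have "v \<bullet> (lyapunov_lhs n N K P Q' \<rho> i A B *\<^sub>v v) \<le> 0" if v: "v \<in> carrier_vec n" for v
    proof -
      define p where "p j = v \<bullet> (P j *\<^sub>v v)" for j
      have "(\<Sum>j<N. \<rho> $$ (j, i) * p j) =
          (\<Sum>j<N. \<pi> $$ (j, i) * p j + \<eta> * p j - (if j = i then \<eta> * real N * p j else 0))"
        using i by (intro sum.cong) (auto simp: \<rho>_def algebra_simps)
      also have "\<dots> = (\<Sum>j<N. \<pi> $$ (j, i) * p j) + \<eta> * (\<Sum>j<N. p j) - \<eta> * real N * p i"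
        using i by (simp add: sum.distrib sum_subtractf sum_distrib_left)
      finally have "v \<bullet> (lyapunov_lhs n N K P Q' \<rho> i A B *\<^sub>v v) =
          v \<bullet> (lyapunov_lhs n N K P Q \<pi> i A B *\<^sub>v v) + \<eta> * (\<Sum>j<N. p j) - \<eta> * real N * p i
          + \<epsilon> / 2 * (v \<bullet> v)"
        using Ps(2) add_scalar_identity_pos_def(2)[OF Q half v, folded Q'_def]
        by (simp add: lyapunov_lhs_quadratic_form[where K = K and i = i, OF AB_carrier Ki _ Qc i v]
            lyapunov_lhs_quadratic_form[where K = K and i = i, OF AB_carrier Ki _ Q's(2) i v] p_def)
      moreover have "v \<bullet> (lyapunov_lhs n N K P Q \<pi> i A B *\<^sub>v v) \<le> - \<epsilon> * (v \<bullet> v)"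
        using e(2)[OF i AB v] mult_right_mono[OF \<epsilon>(2)[OF i] vv[OF v]] by simp
      moreover have "\<eta> * (\<Sum>j<N. p j) \<le> \<epsilon> / 2 * (v \<bullet> v)"
      proof -
        have "\<eta> * (\<Sum>j<N. p j) \<le> \<eta> * (C * (v \<bullet> v))"
          using sum_P[OF v] \<eta>(1) by (simp add: p_def)
        also have "\<dots> \<le> \<epsilon> / 2 * (v \<bullet> v)"
          using mult_right_mono[OF \<eta>(2) vv[OF v]] by (simp add: mult.assoc)
        finally show ?thesis .
      qed
      \<comment> \<open>The diagonal correction enters with a minus sign, so it only lowers the form
        and needs no share of the margin.\<close>
      moreover have "0 \<le> \<eta> * real N * p i"
        using \<eta>(1) Pv[OF i v] by (simp add: p_def)
      ultimately show ?thesis by linarith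
    qed
    then show ?thesis
      using symmetric_mat_lyapunov_lhs[where K = K and i = i, OF AB_carrier Ki Ps(1) Q's(1) i] by (simp add: neg_semidef_def)
  qed
  moreover have "\<rho> \<in> pos_rate_mats N" unfolding \<rho>_def by (rule perturbed_rate_mat[OF \<pi> \<eta>(1)])
  ultimately show ?strict using K P Q' by blast
qed

end
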